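(* For every $\epsilon>0$ and every function $p=p(n)$ with $0<p(n)<1-\epsilon$ and $n\,p(n)\to\infty$ as $n\to\infty$, the following holds asymptotically almost surely: \[ (1-\epsilon)\frac{\ln (np)}{-\ln (1-\mu(p))}\ \leq\ \chi_{CF}(G(n,p))\ \leq\ (1+\epsilon)\frac{\ln (np)}{-\ln (1-\mu(p))}.\]
   Context: All graphs are finite and simple. For a vertex $x$ of a graph $G=(V,E)$, $N(x)=\{y\in V: xy\in E\}$ is its neighborhood and $N[x]=N(x)\cup\{x\}$ its closed neighborhood. A (not necessarily proper) vertex coloring of $G$ is called conflict-free if for each $x\in V$ there exists $y\in N[x]$ whose color is different from the color of each other vertex in $N[x]$. The conflict-free chromatic number $\chi_{CF}(G)$ is the smallest $r$ such that $G$ has a conflict-free coloring with $r$ colors. $G(n,p)$ denotes the Erdős–Rényi random graph on $n$ vertices, in which each pair of vertices is an edge independently with probability $p$. "Asymptotically almost surely" means with probability tending to $1$ as $n\to\infty$. For $0<p<1$, \[\mu(p)=\max\{ip(1-p)^{i-1}: i\in\mathbb{N}^+\}.\] (The maximum is attained at $i=\lfloor 1/p\rfloor$.) *)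

theory Defs
  imports "HOL-Probability.Probability"
begin

(* A finite simple graph is given by a finite vertex set V and a set E of two-element subsets of V. *)

definition nbhd :: "'a set \<Rightarrow> 'a set set \<Rightarrow> 'a \<Rightarrow> 'a set" where
  "nbhd V E x = {y \<in> V. {x, y} \<in> E}"

definition closed_nbhd :: "'a set \<Rightarrow> 'a set set \<Rightarrow> 'a \<Rightarrow> 'a set" where
  "closed_nbhd V E x = nbhd V E x \<union> {x}"

definition conflict_free :: "'a set \<Rightarrow> 'a set set \<Rightarrow> ('a \<Rightarrow> 'c) \<Rightarrow> bool" where
  "conflict_free V E c \<longleftrightarrow>
     (\<forall>x\<in>V. \<exists>y\<in>closed_nbhd V E x. \<forall>z\<in>closed_nbhd V E x. z \<noteq> y \<longrightarrow> c z \<noteq> c y)"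

(* The colours are 0, ..., r - 1; not all of them need to occur, which does not affect the least r. *)
definition chi_CF :: "'a set \<Rightarrow> 'a set set \<Rightarrow> nat" where
  "chi_CF V E = (LEAST r. \<exists>c :: 'a \<Rightarrow> nat. c ` V \<subseteq> {..<r} \<and> conflict_free V E c)"

lemma chi_CF_colouring_exists:
  fixes V :: "'a set"
  assumes "finite V"
  shows "\<exists>c :: 'a \<Rightarrow> nat. c ` V \<subseteq> {..<chi_CF V E} \<and> conflict_free V E c"
proof -
  obtain c :: "'a \<Rightarrow> nat" where c: "bij_betw c V {0..<card V}"
    using ex_bij_betw_finite_nat[OF assms] by blast
  have "conflict_free V E c"
    unfolding conflict_free_def
  proof
    fix x assume x: "x \<in> V"
    have sub: "closed_nbhd V E x \<subseteq> V"
      using x by (auto simp: closed_nbhd_def nbhd_def)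
    have "\<forall>z\<in>closed_nbhd V E x. z \<noteq> x \<longrightarrow> c z \<noteq> c x"
      using sub x c by (auto simp: bij_betw_def inj_on_def)
    then show "\<exists>y\<in>closed_nbhd V E x. \<forall>z\<in>closed_nbhd V E x. z \<noteq> y \<longrightarrow> c z \<noteq> c y"
      by (auto simp: closed_nbhd_def)
  qed
  moreover have "c ` V \<subseteq> {..<card V}"
    using c by (auto simp: bij_betw_def)
  ultimately have "\<exists>c :: 'a \<Rightarrow> nat. c ` V \<subseteq> {..<card V} \<and> conflict_free V E c"
    by blast
  then show ?thesis
    unfolding chi_CF_def by (rule LeastI)
qed

definition vertex_pairs :: "nat \<Rightarrow> nat set set" where
  "vertex_pairs n = {e. e \<subseteq> {..<n} \<and> card e = 2}"

(* G(n,p) as a distribution on edge sets over the vertex set {..<n}. *)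
definition gnp :: "nat \<Rightarrow> real \<Rightarrow> nat set set pmf" where
  "gnp n p = map_pmf (\<lambda>b. {e \<in> vertex_pairs n. b e})
     (Pi_pmf (vertex_pairs n) False (\<lambda>_. bernoulli_pmf p))"

(* Max is of no use here, since the set of values is infinite. *)
definition mu :: "real \<Rightarrow> real" where
  "mu p = (GREATEST m. \<exists>i::nat. i \<ge> 1 \<and> m = real i * p * (1 - p) ^ (i - 1))"

lemma mu_eq:
  assumes p: "0 < p" "p < 1"
  defines "k \<equiv> nat \<lfloor>1 / p\<rfloor>"
  shows "k \<ge> 1" and "mu p = real k * p * (1 - p) ^ (k - 1)"
    and "\<And>i. i \<ge> 1 \<Longrightarrow> real i * p * (1 - p) ^ (i - 1) \<le> mu p"
proof -
  define a where "a i = real i * p * (1 - p) ^ (i - 1)" for i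
  have fl: "\<lfloor>1 / p\<rfloor> \<ge> 1" using p by (simp add: le_floor_iff)
  then have "nat 1 \<le> k" unfolding k_def by (rule nat_mono)
  then show k1: "k \<ge> 1" by simp
  have rk: "real k = of_int \<lfloor>1 / p\<rfloor>"
    using fl unfolding k_def by (intro of_nat_nat) linarith
  have kle: "real k * p \<le> 1"
  proof -
    have "real k \<le> 1 / p" unfolding rk by (rule of_int_floor_le)
    then show ?thesis using p(1) by (metis pos_le_divide_eq)
  qed
  have kgt: "1 < (real k + 1) * p"
  proof -
    have "1 / p < real k + 1" unfolding rk using floor_correct[of "1 / p"] by simp
    then show ?thesis using p(1) by (metis pos_divide_less_eq)
  qed
  have step: "a (Suc i) = real (Suc i) * (1 - p) * (p * (1 - p) ^ (i - 1))"
    and base: "a i = real i * (p * (1 - p) ^ (i - 1))" if "i \<ge> 1" for i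
    using that by (cases i; simp add: a_def)+
  have up: "a i \<le> a (Suc i)" if "1 \<le> i" "i < k" for i
  proof -
    have "real (Suc i) * p \<le> real k * p" using that p by simp
    then have "real i \<le> real (Suc i) * (1 - p)" using kle by (simp add: algebra_simps)
    then show ?thesis unfolding step[OF that(1)] base[OF that(1)]
      using p by (intro mult_right_mono) auto
  qed
  have down: "a (Suc i) \<le> a i" if "k \<le> i" for i
  proof -
    have i1: "1 \<le> i" using that k1 by simp
    have "(real k + 1) * p \<le> real (Suc i) * p" using that p by simp
    then have "real (Suc i) * (1 - p) \<le> real i" using kgt by (simp add: algebra_simps)
    then show ?thesis unfolding step[OF i1] base[OF i1]
      using p by (intro mult_right_mono) auto
  qed
  have le: "a i \<le> a k" if "i \<ge> 1" for i
  proof (cases "i \<le> k")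
    case True
    then show ?thesis using that
    proof (induction rule: inc_induct)
      case (step j)
      then show ?case using up[of j] by simp
    qed simp
  next
    case False
    then have "k \<le> i" by simp
    then show ?thesis
    proof (induction rule: dec_induct)
      case (step j)
      then show ?case using down[of j] by simp
    qed simp
  qed
  have mu: "mu p = a k"
    unfolding mu_def using k1 le by (intro Greatest_equality) (auto simp: a_def)
  then show "mu p = real k * p * (1 - p) ^ (k - 1)" by (simp add: a_def)
  show "\<And>i. i \<ge> 1 \<Longrightarrow> real i * p * (1 - p) ^ (i - 1) \<le> mu p"
    using le mu by (simp add: a_def)
qed

end

theory Submission
  imports Defs "HOL-Real_Asymp.Real_Asymp"
begin

text \<open>Write \<open>\<lambda> = ln (np)\<close>. A vertex sees exactly one vertex of a class of size \<open>k\<close> with probability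
  \<open>k p (1 - p)^(k - 1) \<le> mu p\<close>, so \<open>r\<close> classes fail to serve it with probability at least
  \<open>(1 - mu p)^r\<close>, with equality for classes of size \<open>\<lfloor>1/p\<rfloor>\<close>.

  Lower bound: classes with more than \<open>4 \<lambda> / p\<close> vertices serve only \<open>O(\<lambda> / p)\<close> vertices each, so only
  the small classes matter. There are \<open>exp (polylog (np) / p)\<close> ways to choose these, while
  \<open>r \<le> (1 - \<epsilon>) \<lambda> / - ln (1 - mu p)\<close> of them serve almost all vertices with probability at most
  \<open>exp (- (np)^\<epsilon> / 2p)\<close>.

  Upper bound: take about \<open>(1 + \<delta>) \<lambda> / - ln (1 - mu p)\<close> independent classes of size \<open>\<lfloor>1/p\<rfloor>\<close> inside a small
  vertex set, and a further \<open>\<delta>\<close>-fraction of classes outside of it to serve that set. Independence makes every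
  vertex of a class its own unique colour. Fewer than \<open>1/p\<close> vertices stay unserved, and
  every set of that size induces a \<open>\<delta> \<lambda>\<close>-degenerate graph, hence can be properly coloured with few new
  colours. All remaining vertices get one common dummy colour.\<close>

section \<open>Random subsets\<close>

text \<open>This plays the part of measurability with respect to the coordinates in
  \<open>D\<close>. Independence below is always derived from disjointness of such sets
  \<open>D\<close>.\<close>

definition depends_on :: "'a set \<Rightarrow> ('a set \<Rightarrow> bool) \<Rightarrow> bool" where
  "depends_on D F \<longleftrightarrow> (\<forall>E. F E \<longleftrightarrow> F (E \<inter> D))"

lemma depends_onI:
  assumes "\<And>E E'. E \<inter> D = E' \<inter> D \<Longrightarrow> F E = F E'"
  shows "depends_on D F"
  unfolding depends_on_def
proof
  fix E
  have "E \<inter> D = (E \<inter> D) \<inter> D" by blast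
  then show "F E = F (E \<inter> D)" by (rule assms)
qed

lemma depends_onD: "depends_on D F \<Longrightarrow> F E = F (E \<inter> D)"
  unfolding depends_on_def by (rule spec)

lemma depends_on_cong:
  assumes "depends_on D F" "E \<inter> D = E' \<inter> D"
  shows "F E = F E'"
proof -
  have "F E = F (E \<inter> D)" by (rule depends_onD[OF assms(1)])
  also have "\<dots> = F (E' \<inter> D)" by (simp only: assms(2))
  also have "\<dots> = F E'" by (rule depends_onD[OF assms(1), symmetric])
  finally show ?thesis .
qed

lemma depends_on_ball: "(\<And>j. j \<in> J \<Longrightarrow> depends_on (D j) (F j)) \<Longrightarrow> depends_on (\<Union>j\<in>J. D j) (\<lambda>E. \<forall>j\<in>J. F j E)"
proof (rule depends_onI)
  fix E E' assume dep: "\<And>j. j \<in> J \<Longrightarrow> depends_on (D j) (F j)" and eq: "E \<inter> (\<Union>j\<in>J. D j) = E' \<inter> (\<Union>j\<in>J. D j)"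
  have "F j E = F j E'" if "j \<in> J" for j
    using that eq by (intro depends_on_cong[OF dep[OF that]]) blast
  then show "(\<forall>j\<in>J. F j E) = (\<forall>j\<in>J. F j E')" by blast
qed

section \<open>Elementary probability bounds and the counting of small subsets\<close>

lemma prob_union_bound:
  assumes "finite I" "\<And>i. i \<in> I \<Longrightarrow> measure_pmf.prob M {E. F i E} \<le> \<beta>"
  shows "measure_pmf.prob M {E. \<exists>i\<in>I. F i E} \<le> real (card I) * \<beta>"
proof -
  have "{E. \<exists>i\<in>I. F i E} = (\<Union>i\<in>I. {E. F i E})" by blast
  then have "measure_pmf.prob M {E. \<exists>i\<in>I. F i E} \<le> (\<Sum>i\<in>I. measure_pmf.prob M {E. F i E})"
    using measure_pmf.finite_measure_subadditive_finite[OF assms(1), of "\<lambda>i. {E. F i E}" M] by simp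
  also have "\<dots> \<le> real (card I) * \<beta>"
    by (rule sum_bounded_above) (rule assms(2))
  finally show ?thesis .
qed

lemma prob_mono: "(\<And>E. E \<in> set_pmf M \<Longrightarrow> F E \<Longrightarrow> G E) \<Longrightarrow> measure_pmf.prob M {E. F E} \<le> measure_pmf.prob M {E. G E}"
  by (rule measure_pmf.finite_measure_mono_AE) (auto simp: AE_measure_pmf_iff)

lemma prob_disj_le:
  "measure_pmf.prob M {E. F E \<or> G E} \<le> measure_pmf.prob M {E. F E} + measure_pmf.prob M {E. G E}"
  using measure_Un_le[of "{E. F E}" "measure_pmf M" "{E. G E}"] by (simp add: Collect_disj_eq)

lemma prob_ex_disjoint:
  assumes "finite I" "\<And>i j E. i \<in> I \<Longrightarrow> j \<in> I \<Longrightarrow> F i E \<Longrightarrow> F j E \<Longrightarrow> i = j"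
  shows "measure_pmf.prob M {E. \<exists>i\<in>I. F i E} = (\<Sum>i\<in>I. measure_pmf.prob M {E. F i E})"
proof -
  have "disjoint_family_on (\<lambda>i. {E. F i E}) I"
    using assms(2) unfolding disjoint_family_on_def by blast
  then have "measure_pmf.prob M (\<Union>i\<in>I. {E. F i E}) = (\<Sum>i\<in>I. measure_pmf.prob M {E. F i E})"
    using assms(1) by (intro measure_pmf.finite_measure_finite_Union) auto
  moreover have "(\<Union>i\<in>I. {E. F i E}) = {E. \<exists>i\<in>I. F i E}" by blast
  ultimately show ?thesis by simp
qed

text \<open>Generating function of the subsets by size: each element of \<open>V\<close> is either
  absent, with factor \<open>1\<close>, or present, with factor \<open>x\<close>.\<close>

lemma sum_power_card:
  fixes x :: real
  assumes "finite V"
  shows "(\<Sum>A\<in>Pow V. x ^ card A) = (1 + x) ^ card V"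
  using assms
proof (induction V)
  case (insert a V)
  have "(\<Sum>A\<in>insert a ` Pow V. x ^ card A) = (\<Sum>A\<in>Pow V. x ^ card (insert a A))"
    using insert.hyps(2) by (subst sum.reindex) (auto simp: inj_on_def)
  also have "\<dots> = (\<Sum>A\<in>Pow V. x * x ^ card A)"
  proof (intro sum.cong refl)
    fix A assume "A \<in> Pow V"
    then have "finite A" "a \<notin> A" using insert.hyps finite_subset by auto
    then show "x ^ card (insert a A) = x * x ^ card A" by simp
  qed
  finally have "(\<Sum>A\<in>insert a ` Pow V. x ^ card A) = x * (\<Sum>A\<in>Pow V. x ^ card A)"
    by (simp add: sum_distrib_left)
  moreover have "Pow V \<inter> insert a ` Pow V = {}" using insert.hyps(2) by auto
  ultimately show ?case
    using insert by (simp add: Pow_insert sum.union_disjoint algebra_simps)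
qed simp

text \<open>With weights \<open>x ^ card A\<close>, every counted set weighs at least
  \<open>x ^ t\<close> because \<open>x \<le> 1\<close>, while all subsets together weigh
  \<open>(1 + x) ^ card V\<close>. The parameter \<open>x\<close> is chosen anew in each
  application.\<close>

lemma card_subsets_le:
  fixes x :: real
  assumes "finite V" "0 < x" "x \<le> 1"
  shows "real (card {A. A \<subseteq> V \<and> card A \<le> t}) \<le> (1 / x) ^ t * exp (x * card V)"
proof -
  let ?S = "{A. A \<subseteq> V \<and> card A \<le> t}"
  have "real (card ?S) * x ^ t \<le> (\<Sum>A\<in>?S. x ^ card A)"
    using assms by (intro sum_bounded_below power_decreasing) auto
  also have "\<dots> \<le> (\<Sum>A\<in>Pow V. x ^ card A)"
    using assms by (intro sum_mono2) auto
  also have "\<dots> \<le> exp x ^ card V"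
    unfolding sum_power_card[OF assms(1)] using assms by (intro power_mono) auto
  also have "\<dots> = exp (x * card V)" by (metis exp_of_nat_mult mult.commute)
  finally show ?thesis using assms by (simp add: field_simps)
qed

text \<open>Abstracts from graphs: each element of \<open>A\<close> is kept independently with
  probability \<open>p\<close>. The body of \<open>P\<close> has the shape of \<open>gnp\<close>, so
  random edge sets become an instance by unfolding.\<close>

locale binomial_subset =
  fixes A :: "'a set" and p :: real and P :: "'a set pmf"
  assumes finite_A: "finite A" and p_nonneg: "0 \<le> p" and p_le_1: "p \<le> 1"
  defines "P \<equiv> map_pmf (\<lambda>b. {e \<in> A. b e}) (Pi_pmf A False (\<lambda>_. bernoulli_pmf p))"
begin

abbreviation prob :: "('a set \<Rightarrow> bool) \<Rightarrow> real" where
  "prob F \<equiv> measure_pmf.prob P {E. F E}"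

lemma prob_Int_eq:
  assumes "M \<subseteq> A" "X \<subseteq> M"
  shows "prob (\<lambda>E. E \<inter> M = X) = p ^ card X * (1 - p) ^ (card M - card X)"
proof -
  \<comment> \<open>The trace on \<open>M\<close> is prescribed coordinate by coordinate, with no
    constraint outside \<open>M\<close>; so the event is a box and its probability a
    product.\<close>
  define B where "B e = (if e \<in> M then {e \<in> X} else UNIV)" for e
  have fin: "finite M" using assms finite_A finite_subset by blast
  have "(\<lambda>b. {e \<in> A. b e}) -` {E. E \<inter> M = X} = Pi A B"
  proof (intro equalityI subsetI)
    fix b assume "b \<in> (\<lambda>b. {e \<in> A. b e}) -` {E. E \<inter> M = X}"
    then have "{e \<in> A. b e} \<inter> M = X" by simp
    then have "b e \<longleftrightarrow> e \<in> X" if "e \<in> M" for e using that assms by blast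
    then show "b \<in> Pi A B" by (simp add: Pi_def B_def)
  next
    fix b assume "b \<in> Pi A B"
    then have "b e \<longleftrightarrow> e \<in> X" if "e \<in> M" for e
      using that assms(1) unfolding Pi_def B_def by fastforce
    then show "b \<in> (\<lambda>b. {e \<in> A. b e}) -` {E. E \<inter> M = X}"
      using assms by blast
  qed
  then have "prob (\<lambda>E. E \<inter> M = X) = (\<Prod>e\<in>A. measure_pmf.prob (bernoulli_pmf p) (B e))"
    unfolding P_def measure_map_pmf by (simp add: measure_Pi_pmf_Pi[OF finite_A])
  also have "\<dots> = (\<Prod>e\<in>M. measure_pmf.prob (bernoulli_pmf p) {e \<in> X})"
    using assms finite_A by (intro prod.mono_neutral_cong_right) (auto simp: B_def)
  also have "\<dots> = (\<Prod>e\<in>M. if e \<in> X then p else 1 - p)"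
    using p_nonneg p_le_1 by (intro prod.cong) (auto simp: measure_pmf_single)
  also have "\<dots> = p ^ card X * (1 - p) ^ card (M - X)"
    using fin assms(2) by (simp add: prod.If_cases Int_absorb1 Diff_eq)
  also have "card (M - X) = card M - card X"
    using assms(2) fin finite_subset by (intro card_Diff_subset) auto
  finally show ?thesis .
qed

text \<open>The possible traces \<open>X\<close> on \<open>D\<close> split the event disjointly, and
  each trace has an explicit probability.\<close>

lemma prob_eq_sum_weights:
  assumes "D \<subseteq> A" "depends_on D F"
  shows "prob F = (\<Sum>X\<in>{X. X \<subseteq> D \<and> F X}. p ^ card X * (1 - p) ^ (card D - card X))"
proof -
  have fin: "finite D" using assms(1) finite_A finite_subset by blast
  have "F = (\<lambda>E. \<exists>X\<in>{X. X \<subseteq> D \<and> F X}. E \<inter> D = X)"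
  proof
    fix E
    show "F E = (\<exists>X\<in>{X. X \<subseteq> D \<and> F X}. E \<inter> D = X)"
      using depends_onD[OF assms(2), of E] by auto
  qed
  then have "prob F = prob (\<lambda>E. \<exists>X\<in>{X. X \<subseteq> D \<and> F X}. E \<inter> D = X)"
    by (rule arg_cong)
  also have "\<dots> = (\<Sum>X\<in>{X. X \<subseteq> D \<and> F X}. prob (\<lambda>E. E \<inter> D = X))"
    using fin by (intro prob_ex_disjoint) auto
  finally have "prob F = (\<Sum>X\<in>{X. X \<subseteq> D \<and> F X}. prob (\<lambda>E. E \<inter> D = X))" .
  then show ?thesis using assms(1) by (simp add: prob_Int_eq)
qed

text \<open>Independence: a trace on \<open>D1 \<union> D2\<close> amounts to a pair of traces, and
  the weights multiply.\<close>

lemma prob_conj: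
  assumes "D1 \<subseteq> A" "D2 \<subseteq> A" "D1 \<inter> D2 = {}" "depends_on D1 F" "depends_on D2 G"
  shows "prob (\<lambda>E. F E \<and> G E) = prob F * prob G"
proof -
  have fin: "finite D1" "finite D2" using assms finite_A finite_subset by blast+
  have card_Un: "card (D1 \<union> D2) = card D1 + card D2"
    using fin assms(3) by (rule card_Un_disjoint)
  have dep: "depends_on (D1 \<union> D2) (\<lambda>E. F E \<and> G E)"
  proof (rule depends_onI)
    fix E E' assume "E \<inter> (D1 \<union> D2) = E' \<inter> (D1 \<union> D2)"
    then have "E \<inter> D1 = E' \<inter> D1" "E \<inter> D2 = E' \<inter> D2" by blast+
    then show "(F E \<and> G E) = (F E' \<and> G E')"
      using depends_on_cong assms(4,5) by metis
  qed
  have "prob F * prob G = (\<Sum>(X, Y)\<in>{X. X \<subseteq> D1 \<and> F X} \<times> {Y. Y \<subseteq> D2 \<and> G Y}.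
      (p ^ card X * (1 - p) ^ (card D1 - card X)) * (p ^ card Y * (1 - p) ^ (card D2 - card Y)))"
    by (simp add: prob_eq_sum_weights[OF assms(1,4)] prob_eq_sum_weights[OF assms(2,5)]
        sum_product sum.cartesian_product)
  also have "\<dots> = (\<Sum>Z\<in>{Z. Z \<subseteq> D1 \<union> D2 \<and> F Z \<and> G Z}.
      p ^ card Z * (1 - p) ^ (card (D1 \<union> D2) - card Z))"
  proof (rule sum.reindex_bij_witness[where i = "\<lambda>Z. (Z \<inter> D1, Z \<inter> D2)" and j = "\<lambda>(X, Y). X \<union> Y"])
    fix XY assume "XY \<in> {X. X \<subseteq> D1 \<and> F X} \<times> {Y. Y \<subseteq> D2 \<and> G Y}"
    then obtain X Y where XY: "XY = (X, Y)" "X \<subseteq> D1" "Y \<subseteq> D2" "F X" "G Y" by auto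
    have int: "(X \<union> Y) \<inter> D1 = X" "(X \<union> Y) \<inter> D2 = Y" using XY assms(3) by auto
    show "(case (case XY of (X, Y) \<Rightarrow> X \<union> Y) of Z \<Rightarrow> (Z \<inter> D1, Z \<inter> D2)) = XY"
      using int XY by simp
    show "(case XY of (X, Y) \<Rightarrow> X \<union> Y) \<in> {Z. Z \<subseteq> D1 \<union> D2 \<and> F Z \<and> G Z}"
      using XY int depends_onD[OF assms(4), of "X \<union> Y"] depends_onD[OF assms(5), of "X \<union> Y"] by auto
    have finXY: "finite X" "finite Y" using XY fin finite_subset by blast+
    have "card (X \<union> Y) = card X + card Y"
      using XY finXY assms(3) by (intro card_Un_disjoint) auto
    \<comment> \<open>Natural subtraction is truncated; the exponents split because each trace fits
      into its coordinate set.\<close>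
    moreover have "card X \<le> card D1" "card Y \<le> card D2" using XY fin by (auto intro: card_mono)
    then have "card D1 + card D2 - (card X + card Y) = (card D1 - card X) + (card D2 - card Y)"
      by simp
    ultimately show "p ^ card (case XY of (X, Y) \<Rightarrow> X \<union> Y) * (1 - p) ^ (card (D1 \<union> D2) - card (case XY of (X, Y) \<Rightarrow> X \<union> Y))
      = (case XY of (X, Y) \<Rightarrow> (p ^ card X * (1 - p) ^ (card D1 - card X)) * (p ^ card Y * (1 - p) ^ (card D2 - card Y)))"
      by (simp only: XY card_Un prod.case power_add) (simp add: mult_ac)
  next
    fix Z assume Z: "Z \<in> {Z. Z \<subseteq> D1 \<union> D2 \<and> F Z \<and> G Z}"
    then show "(case (Z \<inter> D1, Z \<inter> D2) of (X, Y) \<Rightarrow> X \<union> Y) = Z" by auto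
    show "(Z \<inter> D1, Z \<inter> D2) \<in> {X. X \<subseteq> D1 \<and> F X} \<times> {Y. Y \<subseteq> D2 \<and> G Y}"
      using Z depends_onD[OF assms(4), of Z] depends_onD[OF assms(5), of Z] by auto
  qed
  also have "\<dots> = prob (\<lambda>E. F E \<and> G E)"
    using assms(1,2) by (intro prob_eq_sum_weights[OF _ dep, symmetric]) auto
  finally show ?thesis by simp
qed

lemma prob_ball:
  assumes "finite J" "\<And>j. j \<in> J \<Longrightarrow> depends_on (D j) (F j)" "\<And>j. j \<in> J \<Longrightarrow> D j \<subseteq> A"
    and "\<And>i j. i \<in> J \<Longrightarrow> j \<in> J \<Longrightarrow> i \<noteq> j \<Longrightarrow> D i \<inter> D j = {}"
  shows "prob (\<lambda>E. \<forall>j\<in>J. F j E) = (\<Prod>j\<in>J. prob (F j))"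
  using assms
proof (induction J)
  case (insert j J)
  have "prob (\<lambda>E. F j E \<and> (\<forall>j\<in>J. F j E)) = prob (F j) * prob (\<lambda>E. \<forall>j\<in>J. F j E)"
  proof (rule prob_conj)
    show "depends_on (\<Union>j\<in>J. D j) (\<lambda>E. \<forall>j\<in>J. F j E)"
      using insert.prems(1) by (intro depends_on_ball) auto
    have "D j \<inter> D i = {}" if "i \<in> J" for i
      using that insert.hyps(2) by (intro insert.prems(3)) auto
    then show "D j \<inter> (\<Union>j\<in>J. D j) = {}" by blast
  qed (use insert.prems in auto)
  then show ?case using insert by simp
qed simp

lemma prob_superset: "M \<subseteq> A \<Longrightarrow> prob (\<lambda>E. M \<subseteq> E) = p ^ card M"
  using prob_Int_eq[of M M] by (simp only: inf.absorb_iff2[symmetric] subset_refl diff_self_eq_0 power_0 mult_1_right)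

lemma prob_Int_empty: "M \<subseteq> A \<Longrightarrow> prob (\<lambda>E. E \<inter> M = {}) = (1 - p) ^ card M"
  using prob_Int_eq[of M "{}"] by simp

lemma prob_Not: "prob (\<lambda>E. \<not> F E) = 1 - prob F"
  using measure_pmf.prob_compl[of "{E. F E}" P] by (simp add: Collect_neg_eq Compl_eq_Diff_UNIV)

text \<open>The events of meeting \<open>M\<close> exactly in \<open>{e}\<close> are disjoint. For
  empty \<open>M\<close> the factor \<open>card M\<close> makes the truncated exponent
  harmless.\<close>

lemma prob_card_Int_eq_1:
  assumes "M \<subseteq> A"
  shows "prob (\<lambda>E. card (E \<inter> M) = 1) = real (card M) * p * (1 - p) ^ (card M - 1)"
proof -
  have fin: "finite M" using assms finite_A finite_subset by blast
  have "(\<lambda>E. card (E \<inter> M) = 1) = (\<lambda>E. \<exists>e\<in>M. E \<inter> M = {e})"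
    by (intro ext) (auto simp: card_1_singleton_iff)
  then have "prob (\<lambda>E. card (E \<inter> M) = 1) = prob (\<lambda>E. \<exists>e\<in>M. E \<inter> M = {e})"
    by (rule arg_cong)
  also have "\<dots> = (\<Sum>e\<in>M. prob (\<lambda>E. E \<inter> M = {e}))"
    using fin by (intro prob_ex_disjoint) auto
  also have "\<dots> = (\<Sum>e\<in>M. p * (1 - p) ^ (card M - 1))"
    using prob_Int_eq[OF assms] by (intro sum.cong) auto
  finally show ?thesis by simp
qed

lemma prob_card_Int_le_1:
  assumes "M \<subseteq> A"
  shows "prob (\<lambda>E. card (E \<inter> M) \<le> 1) \<le> (1 - p) ^ card M + real (card M) * p * (1 - p) ^ (card M - 1)"
proof -
  have "finite M" using assms finite_A finite_subset by blast
  then have "prob (\<lambda>E. card (E \<inter> M) \<le> 1) \<le> prob (\<lambda>E. E \<inter> M = {} \<or> card (E \<inter> M) = 1)"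
    by (intro prob_mono) (auto simp: le_Suc_eq)
  also have "\<dots> \<le> prob (\<lambda>E. E \<inter> M = {}) + prob (\<lambda>E. card (E \<inter> M) = 1)"
    by (rule prob_disj_le)
  finally show ?thesis unfolding prob_Int_empty[OF assms] prob_card_Int_eq_1[OF assms] .
qed

lemma set_P_subset: "E \<in> set_pmf P \<Longrightarrow> E \<subseteq> A"
  unfolding P_def by auto

end

section \<open>Neighbourhoods in the random graph\<close>

definition nbrs :: "'a set set \<Rightarrow> 'a \<Rightarrow> 'a set \<Rightarrow> 'a set" where
  "nbrs E x U = {y \<in> U. {x, y} \<in> E}"

text \<open>The coordinates that decide \<open>nbrs E x U\<close>. For \<open>x \<in> U\<close> the
  singleton \<open>{x}\<close> would occur, hence the condition \<open>x \<notin> U\<close> wherever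
  a star has to consist of vertex pairs.\<close>

definition star :: "'a \<Rightarrow> 'a set \<Rightarrow> 'a set set" where
  "star x U = (\<lambda>y. {x, y}) ` U"

lemma inj_star: "inj_on (\<lambda>y. {x, y}) U"
  by (auto simp: inj_on_def doubleton_eq_iff)

lemma card_star: "card (star x U) = card U"
  unfolding star_def by (rule card_image[OF inj_star])

lemma Int_star: "E \<inter> star x U = (\<lambda>y. {x, y}) ` nbrs E x U"
  by (auto simp: star_def nbrs_def)

lemma card_Int_star: "card (E \<inter> star x U) = card (nbrs E x U)"
  unfolding Int_star by (rule card_image[OF inj_star])

lemma depends_on_nbrs: "depends_on (star x U) (\<lambda>E. F (nbrs E x U))"
proof (rule depends_onI)
  fix E E' assume "E \<inter> star x U = E' \<inter> star x U"
  then have "nbrs E x U = nbrs E' x U" by (auto simp: star_def nbrs_def)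
  then show "F (nbrs E x U) = F (nbrs E' x U)" by simp
qed

text \<open>A common element \<open>{x, y} = {x', y'}\<close> with \<open>x \<noteq> x'\<close>
  would force \<open>x = y'\<close>, a member of \<open>U'\<close>.\<close>

lemma star_disjoint: "x \<noteq> x' \<Longrightarrow> x \<notin> U' \<Longrightarrow> star x U \<inter> star x' U' = {}"
  by (auto simp: star_def doubleton_eq_iff)

lemma star_disjoint': "U \<inter> U' = {} \<Longrightarrow> star x U \<inter> star x U' = {}"
  by (auto simp: star_def doubleton_eq_iff)

lemma star_subset_vertex_pairs: "x < n \<Longrightarrow> U \<subseteq> {..<n} \<Longrightarrow> x \<notin> U \<Longrightarrow> star x U \<subseteq> vertex_pairs n"
  by (auto simp: star_def vertex_pairs_def card_2_iff)

lemma finite_vertex_pairs: "finite (vertex_pairs n)"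
  by (rule finite_subset[of _ "Pow {..<n}"]) (auto simp: vertex_pairs_def)

section \<open>Unique neighbours of a vertex in fixed classes\<close>

locale gnp_graph =
  fixes n :: nat and p :: real
  assumes p_pos: "0 < p" and p_less_1: "p < 1"
begin

sublocale binomial_subset "vertex_pairs n" p "gnp n p"
  using p_pos p_less_1 by unfold_locales (auto simp: finite_vertex_pairs gnp_def)

lemma mu_pos: "0 < mu p"
proof -
  have "p \<le> mu p" using mu_eq(3)[OF p_pos p_less_1, of 1] by simp
  then show ?thesis using p_pos by simp
qed

lemma prob_card_nbrs_eq_1:
  assumes "x < n" "U \<subseteq> {..<n}" "x \<notin> U"
  shows "prob (\<lambda>E. card (nbrs E x U) = 1) = real (card U) * p * (1 - p) ^ (card U - 1)"
  using prob_card_Int_eq_1[OF star_subset_vertex_pairs[OF assms]] by (simp only: card_Int_star card_star)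

lemma prob_card_nbrs_eq_1_le:
  assumes "x < n" "U \<subseteq> {..<n}" "x \<notin> U"
  shows "prob (\<lambda>E. card (nbrs E x U) = 1) \<le> mu p"
\<comment> \<open>\<open>mu\<close> ranges over sizes at least 1, so the empty class, which serves
  nobody, is treated separately.\<close>
proof (cases "card U = 0")
  case True
  then show ?thesis using prob_card_nbrs_eq_1[OF assms] mu_pos by simp
next
  case False
  then show ?thesis unfolding prob_card_nbrs_eq_1[OF assms]
    by (intro mu_eq(3)[OF p_pos p_less_1]) simp
qed

lemma prob_card_nbrs_le_1:
  assumes "x < n" "U \<subseteq> {..<n}" "x \<notin> U"
  shows "prob (\<lambda>E. card (nbrs E x U) \<le> 1) \<le> (1 - p) ^ card U + real (card U) * p * (1 - p) ^ (card U - 1)"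
  using prob_card_Int_le_1[OF star_subset_vertex_pairs[OF assms]] by (simp only: card_Int_star card_star)

text \<open>For \<open>k\<close> coins of bias \<open>p\<close>, exactly one success and no success
  are disjoint events. The induction adds one coin at a time to bound their total by 1; the size
  \<open>nat \<lfloor>1 / p\<rfloor>\<close> then attains \<open>mu p\<close>.\<close>

lemma mu_le: "mu p \<le> 1 - (1 - p) ^ nat \<lfloor>1 / p\<rfloor>"
proof -
  have "real k * p * (1 - p) ^ (k - 1) + (1 - p) ^ k \<le> 1" if "k \<ge> 1" for k
    using that
  proof (induction k rule: dec_induct)
    case (step k)
    have "real (Suc k) * p * (1 - p) ^ (Suc k - 1) + (1 - p) ^ Suc k
      = (1 - p) * (real k * p * (1 - p) ^ (k - 1) + (1 - p) ^ k) + p * (1 - p) ^ k"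
      using step.hyps by (cases k) (simp_all add: algebra_simps)
    also have "\<dots> \<le> (1 - p) * 1 + p * 1"
      using step.IH p_pos p_less_1 by (intro add_mono mult_left_mono power_le_one) auto
    finally show ?case by simp
  qed simp
  then show ?thesis using mu_eq(1,2)[OF p_pos p_less_1] by (simp add: le_diff_eq)
qed

lemma mu_less_1: "mu p < 1"
  using mu_le p_less_1 zero_less_power[of "1 - p" "nat \<lfloor>1 / p\<rfloor>"] by linarith

text \<open>Disjoint classes use disjoint stars at \<open>x\<close>, so their failures are
  independent, and each has probability at least \<open>1 - mu p\<close>.\<close>

lemma prob_no_unique_class:
  assumes "x < n" "finite I" "disjoint_family_on U I" "\<And>i. i \<in> I \<Longrightarrow> U i \<subseteq> {..<n} - {x}"
  shows "(1 - mu p) ^ card I \<le> prob (\<lambda>E. \<forall>i\<in>I. card (nbrs E x (U i)) \<noteq> 1)"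
proof -
  have "prob (\<lambda>E. \<forall>i\<in>I. card (nbrs E x (U i)) \<noteq> 1) = (\<Prod>i\<in>I. prob (\<lambda>E. card (nbrs E x (U i)) \<noteq> 1))"
  proof (rule prob_ball[where D = "\<lambda>i. star x (U i)"])
    fix i j assume "i \<in> I" "j \<in> I" "i \<noteq> j"
    then have "U i \<inter> U j = {}" using assms(3) by (auto simp: disjoint_family_on_def)
    then show "star x (U i) \<inter> star x (U j) = {}" by (rule star_disjoint')
  next
    fix i assume i: "i \<in> I"
    show "depends_on (star x (U i)) (\<lambda>E. card (nbrs E x (U i)) \<noteq> 1)" by (rule depends_on_nbrs)
    show "star x (U i) \<subseteq> vertex_pairs n"
      using assms(1) assms(4)[OF i] by (intro star_subset_vertex_pairs) auto
  qed (rule assms(2))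
  also have "\<dots> \<ge> (\<Prod>i\<in>I. 1 - mu p)"
  proof (rule prod_mono)
    fix i assume i: "i \<in> I"
    have "prob (\<lambda>E. card (nbrs E x (U i)) = 1) \<le> mu p"
      using assms(1) assms(4)[OF i] by (intro prob_card_nbrs_eq_1_le) auto
    then show "0 \<le> 1 - mu p \<and> 1 - mu p \<le> prob (\<lambda>E. card (nbrs E x (U i)) \<noteq> 1)"
      using mu_less_1 unfolding prob_Not by simp
  qed
  finally show ?thesis by simp
qed

text \<open>The vertices of \<open>Q\<close> look at \<open>T\<close> through disjoint stars,
  because \<open>Q\<close> and \<open>T\<close> are disjoint.\<close>

lemma prob_all_few_nbrs_le:
  assumes "T \<subseteq> {..<n}" "Q \<subseteq> {..<n} - T"
    and "(1 - p) ^ card T + real (card T) * p * (1 - p) ^ (card T - 1) \<le> \<beta>"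
  shows "prob (\<lambda>E. \<forall>x\<in>Q. card (nbrs E x T) \<le> 1) \<le> \<beta> ^ card Q"
proof -
  have "prob (\<lambda>E. \<forall>x\<in>Q. card (nbrs E x T) \<le> 1) = (\<Prod>x\<in>Q. prob (\<lambda>E. card (nbrs E x T) \<le> 1))"
  proof (rule prob_ball[where D = "\<lambda>x. star x T"])
    show "finite Q" using assms(2) finite_subset by blast
    fix x assume "x \<in> Q"
    then show "star x T \<subseteq> vertex_pairs n"
      using assms(1,2) by (intro star_subset_vertex_pairs) auto
    show "depends_on (star x T) (\<lambda>E. card (nbrs E x T) \<le> 1)" by (rule depends_on_nbrs)
  qed (use assms(2) in \<open>auto intro!: star_disjoint\<close>)
  also have "\<dots> \<le> (\<Prod>x\<in>Q. \<beta>)"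
  proof (rule prod_mono)
    fix x assume "x \<in> Q"
    then have "prob (\<lambda>E. card (nbrs E x T) \<le> 1) \<le> (1 - p) ^ card T + real (card T) * p * (1 - p) ^ (card T - 1)"
      using assms(1,2) by (intro prob_card_nbrs_le_1) auto
    then show "0 \<le> prob (\<lambda>E. card (nbrs E x T) \<le> 1) \<and> prob (\<lambda>E. card (nbrs E x T) \<le> 1) \<le> \<beta>"
      using assms(3) by simp
  qed
  finally show ?thesis by simp
qed

text \<open>A second level of independence: vertices outside all classes have disjoint stars into
  the union of the classes. For a single vertex, \<open>prob_no_unique_class\<close> bounds the
  failure from below.\<close>

lemma prob_all_unique_class_le:
  assumes "finite I" "disjoint_family_on U I" "\<And>i. i \<in> I \<Longrightarrow> U i \<subseteq> {..<n}"
    and "X \<subseteq> {..<n} - (\<Union>i\<in>I. U i)"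
  shows "prob (\<lambda>E. \<forall>x\<in>X. \<exists>i\<in>I. card (nbrs E x (U i)) = 1) \<le> (1 - (1 - mu p) ^ card I) ^ card X"
proof -
  have "prob (\<lambda>E. \<forall>x\<in>X. \<exists>i\<in>I. card (nbrs E x (U i)) = 1)
    = (\<Prod>x\<in>X. prob (\<lambda>E. \<exists>i\<in>I. card (nbrs E x (U i)) = 1))"
  proof (rule prob_ball[where D = "\<lambda>x. star x (\<Union>i\<in>I. U i)"])
    show "finite X" using assms(4) finite_subset by blast
    fix x assume x: "x \<in> X"
    then show "star x (\<Union>i\<in>I. U i) \<subseteq> vertex_pairs n"
      using assms(3,4) by (intro star_subset_vertex_pairs) auto
    show "depends_on (star x (\<Union>i\<in>I. U i)) (\<lambda>E. \<exists>i\<in>I. card (nbrs E x (U i)) = 1)"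
    proof (rule depends_onI)
      fix E E' assume eq: "E \<inter> star x (\<Union>i\<in>I. U i) = E' \<inter> star x (\<Union>i\<in>I. U i)"
      have "nbrs E x (U i) = nbrs E' x (U i)" if "i \<in> I" for i
        using eq that by (auto simp: star_def nbrs_def)
      then show "(\<exists>i\<in>I. card (nbrs E x (U i)) = 1) = (\<exists>i\<in>I. card (nbrs E' x (U i)) = 1)"
        by auto
    qed
    fix y assume "y \<in> X" "x \<noteq> y"
    then show "star x (\<Union>i\<in>I. U i) \<inter> star y (\<Union>i\<in>I. U i) = {}"
      using x assms(4) by (intro star_disjoint) auto
  qed
  also have "\<dots> \<le> (\<Prod>x\<in>X. 1 - (1 - mu p) ^ card I)"
  proof (rule prod_mono)
    fix x assume x: "x \<in> X"
    have "(1 - mu p) ^ card I \<le> prob (\<lambda>E. \<forall>i\<in>I. card (nbrs E x (U i)) \<noteq> 1)"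
      using x assms by (intro prob_no_unique_class) auto
    moreover have "prob (\<lambda>E. \<exists>i\<in>I. card (nbrs E x (U i)) = 1) = 1 - prob (\<lambda>E. \<forall>i\<in>I. card (nbrs E x (U i)) \<noteq> 1)"
      unfolding prob_Not[symmetric] by simp
    ultimately show "0 \<le> prob (\<lambda>E. \<exists>i\<in>I. card (nbrs E x (U i)) = 1) \<and>
        prob (\<lambda>E. \<exists>i\<in>I. card (nbrs E x (U i)) = 1) \<le> 1 - (1 - mu p) ^ card I"
      by simp
  qed
  finally show ?thesis by simp
qed

end

section \<open>The lower bound\<close>

text \<open>A colour class with at least \<open>t\<close> vertices is only useful to few vertices: a vertex satisfied by it
  sees at most one vertex of any fixed \<open>t\<close>-subset of the class.\<close>

lemma conflict_free_imp_small_classes: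
  fixes c :: "nat \<Rightarrow> nat"
  assumes cf: "conflict_free {..<n} E c" and range: "c ` {..<n} \<subseteq> {..<r}"
    and few: "\<And>T Q. T \<subseteq> {..<n} \<Longrightarrow> card T = t \<Longrightarrow> Q \<subseteq> {..<n} - T \<Longrightarrow> card Q = t \<Longrightarrow> \<exists>x\<in>Q. \<not> card (nbrs E x T) \<le> 1"
  obtains U B where "U \<in> (\<Pi>\<^sub>E i\<in>{..<r}. {U. U \<subseteq> {..<n} \<and> card U \<le> t})" "disjoint_family_on U {..<r}"
    "B \<subseteq> {..<n}" "card B \<le> 2 * r * t"
    "\<forall>x\<in>{..<n} - (\<Union>i<r. U i) - B. \<exists>i<r. card (nbrs E x (U i)) = 1"
proof -
  define C where "C i = {x. x < n \<and> c x = i}" for i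
  define L where "L = {i. i < r \<and> t \<le> card (C i)}"
  have "\<exists>T. T \<subseteq> C i \<and> card T = t" if "i \<in> L" for i
    using that obtain_subset_with_card_n unfolding L_def by (metis mem_Collect_eq)
  then obtain T where T: "T i \<subseteq> C i" "card (T i) = t" if "i \<in> L" for i by metis
  define Q where "Q i = {x \<in> {..<n} - T i. card (nbrs E x (T i)) \<le> 1}" for i
  \<comment> \<open>Large classes are emptied rather than dropped, which keeps the index set
    \<open>{..<r}\<close>.\<close>
  define U where "U = (\<lambda>i\<in>{..<r}. if i \<in> L then {} else C i)"
  \<comment> \<open>For each large colour, the \<open>t\<close> vertices of \<open>T i\<close> and
    the at most \<open>t\<close> vertices of \<open>Q i\<close> are given up; this is the source of
    \<open>2 * r * t\<close>.\<close>
  define B where "B = (\<Union>i\<in>L. T i \<union> Q i)"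
  have Cn: "C i \<subseteq> {..<n}" for i by (auto simp: C_def)
  have Q: "card (Q i) \<le> t" if "i \<in> L" for i
  proof (rule ccontr)
    assume "\<not> card (Q i) \<le> t"
    then obtain Q' where Q': "Q' \<subseteq> Q i" "card Q' = t"
      using obtain_subset_with_card_n[of t "Q i"] by auto
    then have "\<exists>x\<in>Q'. \<not> card (nbrs E x (T i)) \<le> 1"
      using T[OF that] Cn[of i] by (intro few) (auto simp: Q_def)
    then show False using Q' by (auto simp: Q_def)
  qed
  have finL: "finite L" "card L \<le> r" using card_mono[of "{..<r}" L] by (auto simp: L_def)
  have "card B \<le> (\<Sum>i\<in>L. card (T i \<union> Q i))"
    unfolding B_def using finL by (intro card_UN_le)
  also have "\<dots> \<le> (\<Sum>i\<in>L. 2 * t)"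
  proof (rule sum_mono)
    fix i assume i: "i \<in> L"
    show "card (T i \<union> Q i) \<le> 2 * t"
      using card_Un_le[of "T i" "Q i"] T(2)[OF i] Q[OF i] by simp
  qed
  also have "\<dots> \<le> 2 * r * t" using finL by simp
  finally have B: "card B \<le> 2 * r * t" .
  have "\<exists>i<r. card (nbrs E x (U i)) = 1" if x: "x \<in> {..<n} - (\<Union>i<r. U i) - B" for x
  proof -
    from x have xn: "x < n" and xU: "\<And>i. i < r \<Longrightarrow> x \<notin> U i" and xB: "x \<notin> B" by auto
    obtain y where y: "y \<in> closed_nbhd {..<n} E x"
      and uniq: "\<forall>z\<in>closed_nbhd {..<n} E x. z \<noteq> y \<longrightarrow> c z \<noteq> c y"
      using cf xn unfolding conflict_free_def by blast
    define i where "i = c y"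
    have yn: "y < n" using y xn by (auto simp: closed_nbhd_def nbhd_def)
    have ir: "i < r" using range yn unfolding i_def by blast
    \<comment> \<open>If \<open>x\<close> were served by a large colour, it would see no member of
      \<open>T i\<close> except possibly \<open>y\<close>, and so lie in \<open>B\<close>.\<close>
    have "i \<notin> L"
    proof
      assume iL: "i \<in> L"
      have "nbrs E x (T i) \<subseteq> {y}"
        using T(1)[OF iL] uniq by (auto simp: nbrs_def C_def closed_nbhd_def nbhd_def i_def)
      then have "card (nbrs E x (T i)) \<le> 1" using card_mono[of "{y}"] by auto
      then have "x \<in> T i \<union> Q i" using xn by (auto simp: Q_def)
      then show False using xB iL by (auto simp: B_def)
    qed
    then have Ui: "U i = C i" using ir by (simp add: U_def)
    \<comment> \<open>\<open>x\<close> lies in no small class, so it is not its own witness and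
      \<open>y\<close> is a genuine neighbour.\<close>
    have "x \<noteq> y" using xU[OF ir] xn yn Ui by (auto simp: C_def i_def)
    then have "nbrs E x (U i) = {y}"
      using y yn uniq unfolding Ui by (auto simp: nbrs_def C_def closed_nbhd_def nbhd_def i_def)
    then show ?thesis using ir by auto
  qed
  moreover have "U \<in> (\<Pi>\<^sub>E i\<in>{..<r}. {U. U \<subseteq> {..<n} \<and> card U \<le> t})"
    using Cn by (auto simp: U_def L_def)
  moreover have "disjoint_family_on U {..<r}"
    by (auto simp: disjoint_family_on_def U_def C_def)
  moreover have "B \<subseteq> {..<n}" using T(1) Cn by (fastforce simp: B_def Q_def)
  ultimately show thesis using that[of U B] B by blast
qed

section \<open>Union bounds over small classes and discarded vertices\<close>

context gnp_graph
begin

definition small_subsets :: "nat \<Rightarrow> nat set set" where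
  "small_subsets t = {U. U \<subseteq> {..<n} \<and> card U \<le> t}"

lemma finite_small_subsets: "finite (small_subsets t)"
  by (simp add: small_subsets_def)

text \<open>\<open>card_subsets_le\<close> with \<open>x = 1 / (n * p)\<close>, for which
  \<open>x * n = 1 / p\<close>.\<close>

lemma card_small_subsets_le:
  assumes "1 \<le> real n * p"
  shows "real (card (small_subsets t)) \<le> (real n * p) ^ t * exp (1 / p)"
proof -
  have "n > 0" using assms by (cases n) auto
  then have "1 / (real n * p) * real n = 1 / p" by simp
  then show ?thesis
    using card_subsets_le[of "{..<n}" "1 / (real n * p)" t] assms unfolding small_subsets_def by simp
qed

text \<open>The first summand pays for a pair of \<open>t\<close>-sets \<open>T\<close>,
  \<open>Q\<close> violating the last hypothesis of \<open>conflict_free_imp_small_classes\<close>,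
  the second for all choices of the small classes \<open>U\<close> and the exceptional set
  \<open>B\<close> produced there.\<close>

lemma prob_conflict_free_le:
  assumes np: "1 \<le> real n * p" and rt: "3 * r * t \<le> n"
    and \<beta>: "(1 - p) ^ t + real t * p * (1 - p) ^ (t - 1) \<le> \<beta>"
  defines "N \<equiv> \<lambda>t. (real n * p) ^ t * exp (1 / p)"
  shows "prob (\<lambda>E. \<exists>c :: nat \<Rightarrow> nat. c ` {..<n} \<subseteq> {..<r} \<and> conflict_free {..<n} E c)
    \<le> N t * N t * \<beta> ^ t + N t ^ r * N (2 * r * t) * (1 - (1 - mu p) ^ r) ^ (n - 3 * r * t)"
proof -
  define I1 where "I1 = {(T, Q). T \<in> small_subsets t \<and> Q \<in> small_subsets t \<and> card T = t \<and> card Q = t \<and> Q \<inter> T = {}}"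
  define F1 where "F1 = (\<lambda>(T, Q) (E :: nat set set). \<forall>x\<in>Q. card (nbrs E x T) \<le> 1)"
  define I2 where "I2 = {(U, B). U \<in> (\<Pi>\<^sub>E i\<in>{..<r}. small_subsets t) \<and> B \<in> small_subsets (2 * r * t) \<and> disjoint_family_on U {..<r}}"
  define F2 where "F2 = (\<lambda>(U, B) (E :: nat set set). \<forall>x\<in>{..<n} - (\<Union>i<r. U i) - B. \<exists>i\<in>{..<r}. card (nbrs E x (U i)) = 1)"
  have \<beta>0: "0 \<le> \<beta>" using p_pos p_less_1 by (intro order_trans[OF _ \<beta>]) auto
  have N: "real (card (small_subsets s)) \<le> N s" for s
    unfolding N_def by (rule card_small_subsets_le[OF np])
  have N0: "0 \<le> N s" for s using np by (simp add: N_def)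
  have q: "0 \<le> 1 - (1 - mu p) ^ r" "1 - (1 - mu p) ^ r \<le> 1"
    using mu_pos mu_less_1 by (auto intro: power_le_one)
  have sub1: "I1 \<subseteq> small_subsets t \<times> small_subsets t" by (auto simp: I1_def)
  have fin1: "finite I1" by (rule finite_subset[OF sub1]) (simp add: finite_small_subsets)
  have "real (card I1) \<le> real (card (small_subsets t)) * real (card (small_subsets t))"
    using card_mono[OF _ sub1] by (simp add: finite_small_subsets card_cartesian_product flip: of_nat_mult)
  also have "\<dots> \<le> N t * N t" using N N0 by (intro mult_mono) auto
  finally have card1: "real (card I1) \<le> N t * N t" .
  have sub2: "I2 \<subseteq> (\<Pi>\<^sub>E i\<in>{..<r}. small_subsets t) \<times> small_subsets (2 * r * t)" by (auto simp: I2_def)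
  have fin2': "finite ((\<Pi>\<^sub>E i\<in>{..<r}. small_subsets t) \<times> small_subsets (2 * r * t))"
    by (intro finite_cartesian_product finite_PiE finite_small_subsets) simp
  have fin2: "finite I2" by (rule finite_subset[OF sub2 fin2'])
  have "real (card I2) \<le> real (card (small_subsets t)) ^ r * real (card (small_subsets (2 * r * t)))"
    using card_mono[OF fin2' sub2] by (simp add: card_cartesian_product card_PiE flip: of_nat_mult of_nat_power)
  also have "\<dots> \<le> N t ^ r * N (2 * r * t)" using N N0 by (intro mult_mono power_mono) auto
  finally have card2: "real (card I2) \<le> N t ^ r * N (2 * r * t)" .
  have "prob (\<lambda>E. \<exists>c :: nat \<Rightarrow> nat. c ` {..<n} \<subseteq> {..<r} \<and> conflict_free {..<n} E c)
    \<le> prob (\<lambda>E. (\<exists>i\<in>I1. F1 i E) \<or> (\<exists>i\<in>I2. F2 i E))"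
  proof (rule prob_mono)
    fix E assume "\<exists>c :: nat \<Rightarrow> nat. c ` {..<n} \<subseteq> {..<r} \<and> conflict_free {..<n} E c"
    then obtain c :: "nat \<Rightarrow> nat" where c: "conflict_free {..<n} E c" "c ` {..<n} \<subseteq> {..<r}" by blast
    show "(\<exists>i\<in>I1. F1 i E) \<or> (\<exists>i\<in>I2. F2 i E)"
    proof (cases "\<exists>i\<in>I1. F1 i E")
      case False
      have few: "\<exists>x\<in>Q. \<not> card (nbrs E x T) \<le> 1"
        if "T \<subseteq> {..<n}" "card T = t" "Q \<subseteq> {..<n} - T" "card Q = t" for T Q
      proof -
        have "(T, Q) \<in> I1" using that by (auto simp: I1_def small_subsets_def)
        then show ?thesis using False by (auto simp: F1_def)
      qed
      obtain U B where "U \<in> (\<Pi>\<^sub>E i\<in>{..<r}. {U. U \<subseteq> {..<n} \<and> card U \<le> t})" "disjoint_family_on U {..<r}"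
        "B \<subseteq> {..<n}" "card B \<le> 2 * r * t"
        "\<forall>x\<in>{..<n} - (\<Union>i<r. U i) - B. \<exists>i<r. card (nbrs E x (U i)) = 1"
        by (rule conflict_free_imp_small_classes[OF c few])
      then have "(U, B) \<in> I2 \<and> F2 (U, B) E" by (simp add: I2_def F2_def small_subsets_def Bex_def)
      then show ?thesis by blast
    qed simp
  qed
  also have "\<dots> \<le> prob (\<lambda>E. \<exists>i\<in>I1. F1 i E) + prob (\<lambda>E. \<exists>i\<in>I2. F2 i E)"
    by (rule prob_disj_le)
  also have "prob (\<lambda>E. \<exists>i\<in>I1. F1 i E) \<le> real (card I1) * \<beta> ^ t"
  proof (rule prob_union_bound[OF fin1])
    fix i assume "i \<in> I1"
    then obtain T Q where TQ: "i = (T, Q)" "T \<subseteq> {..<n}" "Q \<subseteq> {..<n}" "Q \<inter> T = {}" "card T = t" "card Q = t"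
      by (auto simp: I1_def small_subsets_def)
    then have i: "i = (T, Q)" "T \<subseteq> {..<n}" "Q \<subseteq> {..<n} - T" "card T = t" "card Q = t" by blast+
    show "prob (F1 i) \<le> \<beta> ^ t"
      using prob_all_few_nbrs_le[OF i(2,3), of \<beta>] i \<beta> by (simp add: F1_def)
  qed
  also have "real (card I1) * \<beta> ^ t \<le> N t * N t * \<beta> ^ t"
    using card1 \<beta>0 by (intro mult_right_mono) auto
  also have "prob (\<lambda>E. \<exists>i\<in>I2. F2 i E) \<le> real (card I2) * (1 - (1 - mu p) ^ r) ^ (n - 3 * r * t)"
  proof (rule prob_union_bound[OF fin2])
    fix i assume "i \<in> I2"
    then obtain U B where i: "i = (U, B)" "U \<in> (\<Pi>\<^sub>E i\<in>{..<r}. small_subsets t)"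
      "B \<in> small_subsets (2 * r * t)" "disjoint_family_on U {..<r}"
      by (auto simp: I2_def)
    have U: "U j \<subseteq> {..<n}" "card (U j) \<le> t" if "j < r" for j
      using i(2) that by (auto simp: small_subsets_def)
    define X where "X = {..<n} - (\<Union>i<r. U i) - B"
    have "prob (\<lambda>E. \<forall>x\<in>X. \<exists>i\<in>{..<r}. card (nbrs E x (U i)) = 1) \<le> (1 - (1 - mu p) ^ card {..<r}) ^ card X"
      using i(4) U(1) by (intro prob_all_unique_class_le) (auto simp: X_def)
    also have "\<dots> \<le> (1 - (1 - mu p) ^ card {..<r}) ^ (n - 3 * r * t)"
    proof (rule power_decreasing)
      \<comment> \<open>At most \<open>r * t\<close> vertices lie in small classes and at most
        \<open>2 * r * t\<close> in \<open>B\<close>; at least \<open>n - 3 * r * t\<close> remain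
        to be served.\<close>
      have "card (\<Union>i<r. U i) \<le> (\<Sum>i<r. card (U i))" by (rule card_UN_le) simp
      also have "\<dots> \<le> (\<Sum>i<r. t)" using U(2) by (intro sum_mono) auto
      finally have 1: "card (\<Union>i<r. U i) \<le> r * t" by simp
      have 2: "card B \<le> 2 * r * t" using i(3) by (simp add: small_subsets_def)
      have "n - card (\<Union>i<r. U i) \<le> card ({..<n} - (\<Union>i<r. U i))"
        using diff_card_le_card_Diff[of "\<Union>i<r. U i" "{..<n}"] finite_subset[OF U(1)] by simp
      moreover have "card ({..<n} - (\<Union>i<r. U i)) - card B \<le> card X"
        unfolding X_def using i(3) finite_subset[of B "{..<n}"]
        by (intro diff_card_le_card_Diff) (auto simp: small_subsets_def)
      ultimately show "n - 3 * r * t \<le> card X" using 1 2 by linarith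
    qed (use q in simp_all)
    finally show "prob (F2 i) \<le> (1 - (1 - mu p) ^ r) ^ (n - 3 * r * t)"
      by (simp add: F2_def i(1) X_def)
  qed
  also have "real (card I2) * (1 - (1 - mu p) ^ r) ^ (n - 3 * r * t)
    \<le> N t ^ r * N (2 * r * t) * (1 - (1 - mu p) ^ r) ^ (n - 3 * r * t)"
    using card2 q by (intro mult_right_mono) auto
  finally show ?thesis by simp
qed

end

section \<open>Colouring small vertex sets\<close>

definition pairs :: "'a set \<Rightarrow> 'a set set" where
  "pairs S = {e. e \<subseteq> S \<and> card e = 2}"

lemma pairs_mono: "S \<subseteq> S' \<Longrightarrow> pairs S \<subseteq> pairs S'"
  by (auto simp: pairs_def)

lemma vertex_pairs_eq: "vertex_pairs n = pairs {..<n}"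
  by (simp add: vertex_pairs_def pairs_def)

lemma finite_pairs: "finite S \<Longrightarrow> finite (pairs S)"
  by (rule finite_subset[of _ "Pow S"]) (auto simp: pairs_def)

lemma card_pairs_le:
  assumes "finite S"
  shows "real (card (pairs S)) \<le> (real (card S))\<^sup>2 / 2"
proof -
  have "2 * (card S choose 2) \<le> (card S)\<^sup>2"
    unfolding choose_two power2_eq_square by (simp add: diff_mult_distrib2)
  then have "2 * real (card (pairs S)) \<le> (real (card S))\<^sup>2"
    unfolding pairs_def n_subsets[OF assms] by (metis of_nat_le_iff of_nat_mult of_nat_numeral of_nat_power)
  then show ?thesis by simp
qed

text \<open>Greedy colouring: a vertex with fewer than \<open>s\<close> neighbours in
  \<open>W\<close> is removed, the rest is coloured by induction, and one of the \<open>s\<close>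
  colours is still free for it.\<close>

lemma degenerate_colouring:
  assumes "finite W" "\<And>T. T \<subseteq> W \<Longrightarrow> T \<noteq> {} \<Longrightarrow> \<exists>x\<in>T. card (nbrs E x T) < s"
  shows "\<exists>c :: 'a \<Rightarrow> nat. c ` W \<subseteq> {..<s} \<and> (\<forall>x\<in>W. \<forall>y\<in>W. x \<noteq> y \<longrightarrow> {x, y} \<in> E \<longrightarrow> c x \<noteq> c y)"
  using assms
proof (induction W rule: finite_remove_induct)
  case empty
  show ?case by simp
next
  case (remove W)
  obtain x where x: "x \<in> W" "card (nbrs E x W) < s" using remove.prems[of W] remove.hyps by auto
  have "\<exists>c :: 'a \<Rightarrow> nat. c ` (W - {x}) \<subseteq> {..<s} \<and>
      (\<forall>y\<in>W - {x}. \<forall>z\<in>W - {x}. y \<noteq> z \<longrightarrow> {y, z} \<in> E \<longrightarrow> c y \<noteq> c z)"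
  proof (rule remove.IH[OF x(1)])
    fix T assume "T \<subseteq> W - {x}" "T \<noteq> {}"
    then show "\<exists>x\<in>T. card (nbrs E x T) < s" by (intro remove.prems) auto
  qed
  then obtain c :: "'a \<Rightarrow> nat" where c: "c ` (W - {x}) \<subseteq> {..<s}"
    "\<forall>y\<in>W - {x}. \<forall>z\<in>W - {x}. y \<noteq> z \<longrightarrow> {y, z} \<in> E \<longrightarrow> c y \<noteq> c z"
    by (elim exE conjE) (rule that)
  have fin: "finite (nbrs E x W)" using remove.hyps(1) by (simp add: nbrs_def)
  have "card (c ` nbrs E x W) < card {..<s}" using card_image_le[OF fin, of c] x(2) by simp
  then have "\<not> {..<s} \<subseteq> c ` nbrs E x W" using card_mono[of "c ` nbrs E x W" "{..<s}"] fin by auto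
  then obtain j where j: "j < s" "j \<notin> c ` nbrs E x W" by auto
  have new: "c y \<noteq> j" if "y \<in> W" "{x, y} \<in> E" for y
    using j(2) that by (auto simp: nbrs_def)
  have "(c(x := j)) ` W \<subseteq> {..<s}" using c(1) j(1) by auto
  moreover have "\<forall>y\<in>W. \<forall>z\<in>W. y \<noteq> z \<longrightarrow> {y, z} \<in> E \<longrightarrow> (c(x := j)) y \<noteq> (c(x := j)) z"
  proof (intro ballI impI)
    fix y z assume yz: "y \<in> W" "z \<in> W" "y \<noteq> z" "{y, z} \<in> E"
    then consider "y = x" "z \<noteq> x" "{x, z} \<in> E" | "z = x" "y \<noteq> x" "{x, y} \<in> E" | "y \<noteq> x" "z \<noteq> x"
      by (metis insert_commute)
    then show "(c(x := j)) y \<noteq> (c(x := j)) z"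
      by cases (use new[OF yz(1)] new[OF yz(2)] c(2) yz in auto)
  qed
  ultimately show ?case by (intro exI conjI)
qed

text \<open>Double counting of incidences: every edge inside \<open>T\<close> has two ends, so the
  degree sum is twice the number of edges.\<close>

lemma min_degree_imp_many_edges:
  assumes "finite T" and deg: "\<And>x. x \<in> T \<Longrightarrow> 2 * \<sigma> \<le> card (nbrs E x T)" and two: "\<And>e. e \<in> E \<Longrightarrow> card e = 2"
  shows "\<sigma> * card T \<le> card (E \<inter> pairs T)"
proof -
  have nbrs: "card {e \<in> E \<inter> pairs T. x \<in> e} = card (nbrs E x T)" if "x \<in> T" for x
  proof -
    have "{e \<in> E \<inter> pairs T. x \<in> e} = E \<inter> star x T"
    proof (intro equalityI subsetI)
      fix e assume e: "e \<in> {e \<in> E \<inter> pairs T. x \<in> e}"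
      then obtain y where "e = {x, y}" by (auto simp: pairs_def card_2_iff)
      then show "e \<in> E \<inter> star x T" using e by (auto simp: pairs_def star_def)
    next
      fix e assume "e \<in> E \<inter> star x T"
      then show "e \<in> {e \<in> E \<inter> pairs T. x \<in> e}" using two that by (auto simp: pairs_def star_def)
    qed
    then show ?thesis by (simp add: card_Int_star)
  qed
  have "(\<Sum>x\<in>T. card {e \<in> E \<inter> pairs T. x \<in> e}) = (\<Sum>e\<in>E \<inter> pairs T. 2)"
  proof (rule sum_multicount_gen)
    show "\<forall>e\<in>E \<inter> pairs T. card {x \<in> T. x \<in> e} = 2"
    proof
      fix e assume e: "e \<in> E \<inter> pairs T"
      then have "{x \<in> T. x \<in> e} = e" by (auto simp: pairs_def)
      then show "card {x \<in> T. x \<in> e} = 2" using e two by auto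
    qed
  qed (use assms(1) in \<open>auto intro: finite_pairs\<close>)
  moreover have "(\<Sum>x\<in>T. 2 * \<sigma>) \<le> (\<Sum>x\<in>T. card {e \<in> E \<inter> pairs T. x \<in> e})"
    using deg nbrs by (intro sum_mono) auto
  ultimately show ?thesis by (simp add: mult.commute)
qed

section \<open>Small dense vertex sets are unlikely\<close>

context gnp_graph
begin

text \<open>By \<open>min_degree_imp_many_edges\<close>, some set of
  \<open>\<sigma> * card T\<close> pairs inside \<open>T\<close> is fully present; the union bound
  runs over all such sets.\<close>

lemma prob_min_degree_le:
  assumes "T \<subseteq> {..<n}" "T \<noteq> {}" "1 \<le> \<sigma>"
  shows "prob (\<lambda>E. \<forall>x\<in>T. 2 * \<sigma> \<le> card (nbrs E x T)) \<le> ((exp 1 * real (card T) * p / (2 * real \<sigma>)) ^ \<sigma>) ^ card T"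
proof (cases "2 * \<sigma> \<le> card T")
  \<comment> \<open>Fewer than \<open>2 * \<sigma>\<close> vertices cannot carry such degrees. The
    other case supplies \<open>2 * \<sigma> / \<tau> \<le> 1\<close>, the condition on the counting
    parameter.\<close>
  case False
  have fin: "finite T" using assms(1) finite_subset by blast
  obtain x where x: "x \<in> T" using assms(2) by auto
  have "\<not> (\<forall>x\<in>T. 2 * \<sigma> \<le> card (nbrs E x T))" for E
  proof -
    have "card (nbrs E x T) \<le> card T" using fin by (intro card_mono) (auto simp: nbrs_def)
    then show ?thesis using x False by (intro notI) (meson order_trans)
  qed
  then have "{E. \<forall>x\<in>T. 2 * \<sigma> \<le> card (nbrs E x T)} = {}" by blast
  then have "prob (\<lambda>E. \<forall>x\<in>T. 2 * \<sigma> \<le> card (nbrs E x T)) = 0" by (simp only: measure_empty)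
  also have "0 \<le> ((exp 1 * real (card T) * p / (2 * real \<sigma>)) ^ \<sigma>) ^ card T" using p_pos by simp
  finally show ?thesis .
next
  case True
  define \<tau> where "\<tau> = card T"
  define m where "m = \<sigma> * \<tau>"
  define I where "I = {M. M \<subseteq> pairs T \<and> card M = m}"
  have \<tau>: "2 * \<sigma> \<le> \<tau>" using True by (simp add: \<tau>_def)
  have fin: "finite T" using assms(1) finite_subset by blast
  have finI: "finite I" unfolding I_def by (rule finite_subset[of _ "Pow (pairs T)"]) (auto simp: finite_pairs[OF fin])
  have "prob (\<lambda>E. \<forall>x\<in>T. 2 * \<sigma> \<le> card (nbrs E x T)) \<le> prob (\<lambda>E. \<exists>M\<in>I. M \<subseteq> E)"
  proof (rule prob_mono)
    fix E assume "E \<in> set_pmf (gnp n p)" and deg: "\<forall>x\<in>T. 2 * \<sigma> \<le> card (nbrs E x T)"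
    then have "\<And>e. e \<in> E \<Longrightarrow> card e = 2" using set_P_subset by (auto simp: vertex_pairs_def)
    then have "m \<le> card (E \<inter> pairs T)"
      using deg unfolding m_def \<tau>_def by (intro min_degree_imp_many_edges[OF fin]) auto
    then obtain M where "M \<subseteq> E \<inter> pairs T" "card M = m" by (rule obtain_subset_with_card_n)
    then show "\<exists>M\<in>I. M \<subseteq> E" by (auto simp: I_def)
  qed
  also have "\<dots> \<le> real (card I) * p ^ m"
  proof (rule prob_union_bound[OF finI])
    fix M assume M: "M \<in> I"
    then have "M \<subseteq> vertex_pairs n"
      using pairs_mono[OF assms(1)] by (auto simp: I_def vertex_pairs_eq)
    then show "prob (\<lambda>E. M \<subseteq> E) \<le> p ^ m" using M prob_superset[of M] by (simp add: I_def)
  qed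
  also have "real (card I) \<le> (1 / (2 * real \<sigma> / real \<tau>)) ^ m * exp (2 * real \<sigma> / real \<tau> * card (pairs T))"
  proof -
    have "card I \<le> card {A. A \<subseteq> pairs T \<and> card A \<le> m}"
      by (rule card_mono) (auto simp: I_def finite_pairs[OF fin])
    moreover have "real (card {A. A \<subseteq> pairs T \<and> card A \<le> m})
      \<le> (1 / (2 * real \<sigma> / real \<tau>)) ^ m * exp (2 * real \<sigma> / real \<tau> * card (pairs T))"
      using \<tau> assms(3) by (intro card_subsets_le finite_pairs[OF fin]) auto
    ultimately show ?thesis by linarith
  qed
  also have "\<dots> \<le> (real \<tau> / (2 * real \<sigma>)) ^ m * exp (real m)"
  proof -
    \<comment> \<open>There are at most \<open>\<tau>\<^sup>2 / 2\<close> pairs, so the counting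
      parameter \<open>2 * \<sigma> / \<tau>\<close> turns the exponent into at most
      \<open>m\<close>.\<close>
    have "2 * real \<sigma> / real \<tau> * card (pairs T) \<le> 2 * real \<sigma> / real \<tau> * ((real \<tau>)\<^sup>2 / 2)"
      unfolding \<tau>_def by (intro mult_left_mono card_pairs_le[OF fin]) auto
    also have "\<dots> = real m" using \<tau> assms(3) by (simp add: m_def power2_eq_square)
    finally show ?thesis by (intro mult_mono) auto
  qed
  finally have "prob (\<lambda>E. \<forall>x\<in>T. 2 * \<sigma> \<le> card (nbrs E x T))
      \<le> (real \<tau> / (2 * real \<sigma>)) ^ m * exp (real m) * p ^ m"
    using p_pos by (simp add: mult_right_mono)
  also have "exp (real m) = exp 1 ^ m" using exp_of_nat_mult[of m "1 :: real"] by simp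
  also have "(real \<tau> / (2 * real \<sigma>)) ^ m * exp 1 ^ m * p ^ m = (exp 1 * real \<tau> * p / (2 * real \<sigma>)) ^ m"
    by (simp add: mult_ac flip: power_mult_distrib)
  finally show ?thesis by (simp add: m_def \<tau>_def power_mult)
qed

text \<open>Each set size \<open>\<tau>\<close> contributes at most the \<open>\<tau>\<close>-th
  power of \<open>exp 1 * (n * p) * (exp 1 / (2 * \<sigma>)) ^ \<sigma>\<close>. As this base is at
  most \<open>1 / 2\<close>, the geometric series is at most twice its first term.\<close>

lemma prob_dense_subset_le:
  assumes "1 \<le> \<sigma>" "1 \<le> n" and z: "exp 1 * (real n * p) * (exp 1 / (2 * real \<sigma>)) ^ \<sigma> \<le> 1 / 2"
  shows "prob (\<lambda>E. \<exists>T. T \<subseteq> {..<n} \<and> T \<noteq> {} \<and> real (card T) * p \<le> 1 \<and> (\<forall>x\<in>T. 2 * \<sigma> \<le> card (nbrs E x T)))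
    \<le> 2 * (exp 1 * (real n * p) * (exp 1 / (2 * real \<sigma>)) ^ \<sigma>)"
proof -
  define z where "z = exp 1 * (real n * p) * (exp 1 / (2 * real \<sigma>)) ^ \<sigma>"
  have z0: "0 \<le> z" "z \<le> 1 / 2" using z p_pos by (auto simp: z_def)
  define K where "K = {\<tau>. 1 \<le> \<tau> \<and> \<tau> \<le> n \<and> real \<tau> * p \<le> 1}"
  define I where "I \<tau> = {T. T \<subseteq> {..<n} \<and> card T = \<tau>}" for \<tau>
  have finI: "finite (I \<tau>)" for \<tau> unfolding I_def by (rule finite_subset[of _ "Pow {..<n}"]) auto
  have finK: "finite K" by (rule finite_subset[of _ "{..n}"]) (auto simp: K_def)
  define F where "F T E \<longleftrightarrow> (\<forall>x\<in>T. 2 * \<sigma> \<le> card (nbrs E x T))" for T :: "nat set" and E :: "nat set set"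
  have each: "prob (\<lambda>E. \<exists>T\<in>I \<tau>. F T E) \<le> z ^ \<tau>" if "\<tau> \<in> K" for \<tau>
  proof -
    from that have \<tau>: "1 \<le> \<tau>" "\<tau> \<le> n" "real \<tau> * p \<le> 1" by (auto simp: K_def)
    have "prob (\<lambda>E. \<exists>T\<in>I \<tau>. F T E) \<le> real (card (I \<tau>)) * ((exp 1 * real \<tau> * p / (2 * real \<sigma>)) ^ \<sigma>) ^ \<tau>"
    proof (rule prob_union_bound[OF finI])
      fix T assume T: "T \<in> I \<tau>"
      then have "T \<subseteq> {..<n}" "T \<noteq> {}" "card T = \<tau>" using \<tau>(1) by (auto simp: I_def)
      then show "prob (F T) \<le> ((exp 1 * real \<tau> * p / (2 * real \<sigma>)) ^ \<sigma>) ^ \<tau>"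
        using prob_min_degree_le[of T \<sigma>] assms(1) by (simp add: F_def)
    qed
    also have "real (card (I \<tau>)) \<le> (exp 1 * real n / real \<tau>) ^ \<tau>"
    proof -
      have "card (I \<tau>) \<le> card {A. A \<subseteq> {..<n} \<and> card A \<le> \<tau>}"
        by (rule card_mono) (auto simp: I_def)
      moreover have "real (card {A. A \<subseteq> {..<n} \<and> card A \<le> \<tau>})
        \<le> (1 / (real \<tau> / real n)) ^ \<tau> * exp (real \<tau> / real n * card {..<n})"
        using \<tau> by (intro card_subsets_le) auto
      moreover have "exp (real \<tau> / real n * card {..<n}) = exp 1 ^ \<tau>"
        using assms(2) exp_of_nat_mult[of \<tau> "1 :: real"] by simp
      moreover have "(1 / (real \<tau> / real n)) ^ \<tau> * exp 1 ^ \<tau> = (exp 1 * real n / real \<tau>) ^ \<tau>"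
        by (simp add: mult.commute flip: power_mult_distrib)
      ultimately show ?thesis by simp
    qed
    also have "(exp 1 * real n / real \<tau>) ^ \<tau> * ((exp 1 * real \<tau> * p / (2 * real \<sigma>)) ^ \<sigma>) ^ \<tau> \<le> z ^ \<tau>"
      unfolding power_mult_distrib[symmetric]
    proof (rule power_mono)
      \<comment> \<open>One of the \<open>\<sigma>\<close> factors \<open>\<tau> * p\<close>
        combines with \<open>n / \<tau>\<close> to \<open>n * p\<close>; the other
        \<open>\<rho>\<close> factors are at most 1.\<close>
      obtain \<rho> where \<rho>: "\<sigma> = Suc \<rho>" using assms(1) by (cases \<sigma>) auto
      have "exp 1 * real n / real \<tau> * (exp 1 * real \<tau> * p / (2 * real \<sigma>)) ^ \<sigma>
        = exp 1 * real n / real \<tau> * ((real \<tau> * p) ^ \<sigma> * (exp 1 / (2 * real \<sigma>)) ^ \<sigma>)"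
        by (simp add: mult_ac flip: power_mult_distrib)
      also have "\<dots> = (real \<tau> * p) ^ \<rho> * z"
        using \<tau>(1) unfolding z_def by (simp add: \<rho> field_simps)
      also have "\<dots> \<le> 1 * z" using \<tau> p_pos z0 by (intro mult_right_mono power_le_one) auto
      finally show "exp 1 * real n / real \<tau> * (exp 1 * real \<tau> * p / (2 * real \<sigma>)) ^ \<sigma> \<le> z" by simp
    qed (use p_pos in simp)
    finally show ?thesis using p_pos by (simp add: mult_right_mono)
  qed
  have "prob (\<lambda>E. \<exists>T. T \<subseteq> {..<n} \<and> T \<noteq> {} \<and> real (card T) * p \<le> 1 \<and> F T E)
    \<le> prob (\<lambda>E. \<exists>\<tau>\<in>K. \<exists>T\<in>I \<tau>. F T E)"
  proof (rule prob_mono)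
    fix E assume "\<exists>T. T \<subseteq> {..<n} \<and> T \<noteq> {} \<and> real (card T) * p \<le> 1 \<and> F T E"
    then obtain T where T: "T \<subseteq> {..<n}" "T \<noteq> {}" "real (card T) * p \<le> 1" "F T E" by blast
    have "finite T" using T(1) finite_subset by blast
    then have "card T \<in> K" "T \<in> I (card T)"
      using T card_mono[of "{..<n}" T] by (auto simp: K_def I_def Suc_le_eq card_gt_0_iff)
    then show "\<exists>\<tau>\<in>K. \<exists>T\<in>I \<tau>. F T E" using T(4) by blast
  qed
  also have "\<dots> \<le> (\<Sum>\<tau>\<in>K. prob (\<lambda>E. \<exists>T\<in>I \<tau>. F T E))"
  proof -
    have "{E. \<exists>\<tau>\<in>K. \<exists>T\<in>I \<tau>. F T E} = (\<Union>\<tau>\<in>K. {E. \<exists>T\<in>I \<tau>. F T E})" by blast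
    then show ?thesis
      using measure_pmf.finite_measure_subadditive_finite[OF finK, of "\<lambda>\<tau>. {E. \<exists>T\<in>I \<tau>. F T E}" "gnp n p"] by simp
  qed
  also have "\<dots> \<le> (\<Sum>\<tau>\<in>K. z ^ \<tau>)" using each by (rule sum_mono)
  also have "\<dots> \<le> (\<Sum>\<tau>\<in>{1..n}. z ^ \<tau>)" using z0 by (intro sum_mono2) (auto simp: K_def)
  also have "\<dots> = z * (\<Sum>\<tau><n. z ^ \<tau>)"
    unfolding sum_distrib_left by (rule sum.reindex_bij_witness[of _ Suc "\<lambda>i. i - 1"]) (auto simp flip: power_Suc)
  also have "\<dots> \<le> z * 2"
  proof (rule mult_left_mono[OF _ z0(1)])
    have "(\<Sum>\<tau><n. z ^ \<tau>) \<le> (\<Sum>\<tau><n. (1 / 2) ^ \<tau>)" using z0 by (intro sum_mono power_mono) auto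
    also have "\<dots> \<le> 2" by (simp add: sum_gp_strict)
    finally show "(\<Sum>\<tau><n. z ^ \<tau>) \<le> 2" .
  qed
  finally show ?thesis by (simp add: F_def z_def mult.commute)
qed

end

section \<open>Independent colour classes\<close>

definition indep :: "'a set set \<Rightarrow> 'a set \<Rightarrow> bool" where
  "indep E U \<longleftrightarrow> (\<forall>x\<in>U. \<forall>y\<in>U. x \<noteq> y \<longrightarrow> {x, y} \<notin> E)"

lemma indep_subset: "indep E U \<Longrightarrow> U' \<subseteq> U \<Longrightarrow> indep E U'"
  by (auto simp: indep_def)

lemma indep_insert: "indep E U \<Longrightarrow> nbrs E x U = {} \<Longrightarrow> indep E (insert x U)"
  by (auto simp: indep_def nbrs_def insert_commute)

lemma indep_cong: "E \<inter> pairs S = E' \<inter> pairs S \<Longrightarrow> U \<subseteq> S \<Longrightarrow> indep E U = indep E' U"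
proof -
  assume eq: "E \<inter> pairs S = E' \<inter> pairs S" and "U \<subseteq> S"
  then have "{x, y} \<in> E \<longleftrightarrow> {x, y} \<in> E'" if "x \<in> U" "y \<in> U" "x \<noteq> y" for x y
  proof -
    have "{x, y} \<in> pairs S" using that \<open>U \<subseteq> S\<close> by (auto simp: pairs_def)
    then show ?thesis using eq by blast
  qed
  then show "indep E U = indep E' U" by (auto simp: indep_def)
qed

text \<open>A total choice: for large enough \<open>S\<close> it has exactly \<open>k\<close>
  vertices, and it is independent whenever possible. The fixed size keeps the probability of a
  unique neighbour exact even where no independent set exists.\<close>

definition pick_class :: "nat \<Rightarrow> 'a set \<Rightarrow> 'a set set \<Rightarrow> 'a set" where
  "pick_class k S E = (SOME U. U \<subseteq> S \<and> card U = k \<and> ((\<exists>U'\<subseteq>S. card U' = k \<and> indep E U') \<longrightarrow> indep E U))"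

lemma pick_class:
  assumes "k \<le> card S"
  shows "pick_class k S E \<subseteq> S" "card (pick_class k S E) = k"
    and "\<exists>U\<subseteq>S. card U = k \<and> indep E U \<Longrightarrow> indep E (pick_class k S E)"
proof -
  obtain U0 where U0: "U0 \<subseteq> S" "card U0 = k" using assms by (rule obtain_subset_with_card_n)
  have "\<exists>U. U \<subseteq> S \<and> card U = k \<and> ((\<exists>U'\<subseteq>S. card U' = k \<and> indep E U') \<longrightarrow> indep E U)"
    using U0 by (cases "\<exists>U'\<subseteq>S. card U' = k \<and> indep E U'") auto
  from someI_ex[OF this, folded pick_class_def]
  show "pick_class k S E \<subseteq> S" "card (pick_class k S E) = k"
    "\<exists>U\<subseteq>S. card U = k \<and> indep E U \<Longrightarrow> indep E (pick_class k S E)" by auto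
qed

text \<open>Only edges inside \<open>S\<close> are read, so edges leaving \<open>S\<close> stay
  independent of the chosen class.\<close>

lemma pick_class_cong:
  assumes "E \<inter> pairs S = E' \<inter> pairs S"
  shows "pick_class k S E = pick_class k S E'"
proof -
  have "(U \<subseteq> S \<and> card U = k \<and> ((\<exists>U'\<subseteq>S. card U' = k \<and> indep E U') \<longrightarrow> indep E U))
    = (U \<subseteq> S \<and> card U = k \<and> ((\<exists>U'\<subseteq>S. card U' = k \<and> indep E' U') \<longrightarrow> indep E' U))" for U
    using indep_cong[OF assms] by (metis (no_types, lifting))
  then show ?thesis unfolding pick_class_def by simp
qed

text \<open>A largest independent subset of \<open>S\<close> has fewer than \<open>k\<close>
  vertices and dominates the rest by maximality. Padding it to exactly \<open>k - 1\<close> vertices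
  preserves this and fixes the size for a union bound.\<close>

lemma no_indep_imp_dominating:
  assumes "finite S" "1 \<le> k" "k \<le> card S" and no: "\<And>U. U \<subseteq> S \<Longrightarrow> card U = k \<Longrightarrow> \<not> indep E U"
  obtains J where "J \<subseteq> S" "card J = k - 1" "\<And>x. x \<in> S - J \<Longrightarrow> nbrs E x J \<noteq> {}"
proof -
  define P where "P U \<longleftrightarrow> U \<subseteq> S \<and> indep E U" for U
  have "P {}" by (simp add: P_def indep_def)
  moreover have "\<forall>U. P U \<longrightarrow> card U < Suc (card S)"
    using card_mono[OF assms(1)] by (auto simp: P_def less_Suc_eq_le)
  ultimately obtain U where U: "P U" "\<And>U'. P U' \<Longrightarrow> card U' \<le> card U"
    using ex_has_greatest_nat[of P "{}" card "Suc (card S)"] by auto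
  have finU: "finite U" using U(1) assms(1) finite_subset by (auto simp: P_def)
  have "card U < k"
  proof (rule ccontr)
    assume "\<not> card U < k"
    then obtain U' where "U' \<subseteq> U" "card U' = k" using obtain_subset_with_card_n[of k U] by auto
    then show False using no[of U'] U(1) indep_subset[of E U U'] by (auto simp: P_def)
  qed
  then have "card U \<le> k - 1" "k - 1 \<le> card S" using assms(3) by auto
  then obtain J where J: "U \<subseteq> J" "J \<subseteq> S" "card J = k - 1"
    using exists_subset_between[of U "k - 1" S] U(1) assms(1) by (auto simp: P_def)
  have "nbrs E x J \<noteq> {}" if x: "x \<in> S - J" for x
  proof
    assume "nbrs E x J = {}"
    then have "nbrs E x U = {}" using J(1) by (auto simp: nbrs_def)
    then have "P (insert x U)" using U(1) x by (auto simp: P_def intro: indep_insert)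
    then have "card (insert x U) \<le> card U" by (rule U(2))
    moreover have "x \<notin> U" using x J(1) by blast
    ultimately show False using finU by simp
  qed
  then show thesis using that J by blast
qed

text \<open>Markov's inequality for a sum of indicators.\<close>

lemma markov_card:
  assumes "finite V" "0 < (c :: real)"
  shows "measure_pmf.prob M {E. c < real (card {x \<in> V. F x E})} \<le> (\<Sum>x\<in>V. measure_pmf.prob M {E. F x E}) / c"
proof -
  have "c * measure_pmf.prob M {E. c < real (card {x \<in> V. F x E})}
    = measure_pmf.expectation M (\<lambda>E. c * indicator {E. c < real (card {x \<in> V. F x E})} E)"
    by simp
  also have "\<dots> \<le> measure_pmf.expectation M (\<lambda>E. \<Sum>x\<in>V. indicator {E. F x E} E)"
  proof (rule integral_mono)
    fix E
    have "(\<Sum>x\<in>V. indicator {E. F x E} E :: real) = (\<Sum>x\<in>{x \<in> V. F x E}. 1)"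
      using assms(1) by (intro sum.mono_neutral_cong_right) auto
    then have "(\<Sum>x\<in>V. indicator {E. F x E} E :: real) = real (card {x \<in> V. F x E})" by simp
    then show "c * indicator {E. c < real (card {x \<in> V. F x E})} E \<le> (\<Sum>x\<in>V. indicator {E. F x E} E)"
      by (auto simp: indicator_def)
  qed (auto intro!: Bochner_Integration.integrable_sum integrable_real_mult_indicator simp: less_top[symmetric])
  also have "\<dots> = (\<Sum>x\<in>V. measure_pmf.prob M {E. F x E})"
    by (subst Bochner_Integration.integral_sum) (auto simp: less_top[symmetric])
  finally show ?thesis using assms(2) by (simp add: field_simps)
qed

section \<open>Random independent classes and their unique neighbours\<close>

context gnp_graph
begin

text \<open>The union bound runs over the sets \<open>J\<close> of
  \<open>no_indep_imp_dominating\<close>: at most \<open>(b * exp 1) ^ k\<close> of them, each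
  having to dominate at least \<open>k * (b - 1)\<close> vertices independently. The result is a
  \<open>k\<close>-th power of a number at most 1.\<close>

lemma prob_no_indep_le:
  assumes "S \<subseteq> {..<n}" "card S = k * b" "1 \<le> k" "1 \<le> b"
    and z: "real b * exp 1 * (1 - (1 - p) ^ (k - 1)) ^ (b - 1) \<le> 1"
  shows "prob (\<lambda>E. \<not> (\<exists>U\<subseteq>S. card U = k \<and> indep E U)) \<le> real b * exp 1 * (1 - (1 - p) ^ (k - 1)) ^ (b - 1)"
proof -
  define \<theta> where "\<theta> = 1 - (1 - p) ^ (k - 1)"
  have \<theta>: "0 \<le> \<theta>" "\<theta> \<le> 1" using p_pos p_less_1 by (auto simp: \<theta>_def power_le_one)
  have fin: "finite S" using assms(1) finite_subset by blast
  define I where "I = {J. J \<subseteq> S \<and> card J = k - 1}"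
  have finI: "finite I" unfolding I_def by (rule finite_subset[of _ "Pow S"]) (auto simp: fin)
  have "prob (\<lambda>E. \<not> (\<exists>U\<subseteq>S. card U = k \<and> indep E U)) \<le> prob (\<lambda>E. \<exists>J\<in>I. \<forall>x\<in>S - J. nbrs E x J \<noteq> {})"
  proof (rule prob_mono)
    fix E assume "\<not> (\<exists>U\<subseteq>S. card U = k \<and> indep E U)"
    then have no: "\<And>U. U \<subseteq> S \<Longrightarrow> card U = k \<Longrightarrow> \<not> indep E U" by blast
    have "k \<le> card S" using assms(2,4) by simp
    then obtain J where "J \<subseteq> S" "card J = k - 1" "\<And>x. x \<in> S - J \<Longrightarrow> nbrs E x J \<noteq> {}"
      using no_indep_imp_dominating[OF fin assms(3) _ no] by blast
    then show "\<exists>J\<in>I. \<forall>x\<in>S - J. nbrs E x J \<noteq> {}" by (auto simp: I_def)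
  qed
  also have "\<dots> \<le> real (card I) * \<theta> ^ (k * (b - 1))"
  proof (rule prob_union_bound[OF finI])
    fix J assume "J \<in> I"
    then have J: "J \<subseteq> S" "card J = k - 1" by (auto simp: I_def)
    have "prob (\<lambda>E. \<forall>x\<in>S - J. nbrs E x J \<noteq> {}) = (\<Prod>x\<in>S - J. prob (\<lambda>E. nbrs E x J \<noteq> {}))"
    proof (rule prob_ball[where D = "\<lambda>x. star x J"])
      fix x assume "x \<in> S - J"
      then show "star x J \<subseteq> vertex_pairs n"
        using assms(1) J(1) by (intro star_subset_vertex_pairs) auto
      show "depends_on (star x J) (\<lambda>E. nbrs E x J \<noteq> {})" by (rule depends_on_nbrs)
    qed (use fin in \<open>auto intro!: star_disjoint\<close>)
    also have "\<dots> = (\<Prod>x\<in>S - J. \<theta>)"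
    proof (rule prod.cong[OF refl])
      fix x assume "x \<in> S - J"
      then have "star x J \<subseteq> vertex_pairs n"
        using assms(1) J(1) by (intro star_subset_vertex_pairs) auto
      then have "prob (\<lambda>E. E \<inter> star x J = {}) = (1 - p) ^ (k - 1)"
        by (simp add: prob_Int_empty card_star J(2))
      then show "prob (\<lambda>E. nbrs E x J \<noteq> {}) = \<theta>"
        unfolding prob_Not by (simp add: Int_star \<theta>_def)
    qed
    also have "\<dots> = \<theta> ^ card (S - J)" by simp
    also have "\<dots> \<le> \<theta> ^ (k * (b - 1))"
    proof (rule power_decreasing)
      have "card (S - J) = k * b - (k - 1)"
        using J fin assms(2) finite_subset by (subst card_Diff_subset) auto
      then show "k * (b - 1) \<le> card (S - J)" by (simp add: diff_mult_distrib2)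
    qed (use \<theta> in auto)
    finally show "prob (\<lambda>E. \<forall>x\<in>S - J. nbrs E x J \<noteq> {}) \<le> \<theta> ^ (k * (b - 1))" .
  qed
  also have "\<dots> \<le> (real b ^ k * exp 1 ^ k) * \<theta> ^ (k * (b - 1))"
  proof (rule mult_right_mono)
    have "card I \<le> card {A. A \<subseteq> S \<and> card A \<le> k}"
      by (rule card_mono) (auto simp: I_def fin)
    moreover have "real (card {A. A \<subseteq> S \<and> card A \<le> k}) \<le> (1 / (1 / real b)) ^ k * exp (1 / real b * card S)"
      using assms(4) by (intro card_subsets_le fin) auto
    moreover have "exp (1 / real b * card S) = exp 1 ^ k"
      using assms(2,4) exp_of_nat_mult[of k "1 :: real"] by simp
    ultimately show "real (card I) \<le> real b ^ k * exp 1 ^ k" by simp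
  qed (use \<theta> in simp)
  also have "\<dots> = (real b * exp 1 * \<theta> ^ (b - 1)) ^ k"
    by (simp add: power_mult_distrib power_mult mult.commute[of k])
  also have "\<dots> \<le> (real b * exp 1 * \<theta> ^ (b - 1)) ^ 1"
    using z \<theta> assms(3) by (intro power_decreasing) (auto simp: \<theta>_def)
  finally show ?thesis by (simp add: \<theta>_def)
qed

text \<open>Conditioning on the value \<open>U\<close> of the choice: the choice reads
  \<open>pairs S\<close>, the test at \<open>x\<close> reads \<open>star x U\<close>. Every possible
  \<open>U\<close> has the size that attains \<open>mu p\<close>, so the conditional probability
  does not vary.\<close>

lemma prob_pick_class:
  assumes "x < n" "S \<subseteq> {..<n}" "x \<notin> S" "k \<le> card S" and k: "k = nat \<lfloor>1 / p\<rfloor>"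
  shows "prob (\<lambda>E. card (nbrs E x (pick_class k S E)) \<noteq> 1) = 1 - mu p"
proof -
  define I where "I = {U. U \<subseteq> S \<and> card U = k}"
  have finS: "finite S" using assms(2) finite_subset by blast
  have finI: "finite I" unfolding I_def by (rule finite_subset[of _ "Pow S"]) (auto simp: finS)
  have pick: "pick_class k S E \<in> I" for E using pick_class[OF assms(4)] by (auto simp: I_def)
  have "prob (\<lambda>E. card (nbrs E x (pick_class k S E)) \<noteq> 1)
    = prob (\<lambda>E. \<exists>U\<in>I. pick_class k S E = U \<and> card (nbrs E x U) \<noteq> 1)"
    using pick by (simp add: conj_commute)
  also have "\<dots> = (\<Sum>U\<in>I. prob (\<lambda>E. pick_class k S E = U \<and> card (nbrs E x U) \<noteq> 1))"
    by (rule prob_ex_disjoint[OF finI]) simp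
  also have "\<dots> = (\<Sum>U\<in>I. prob (\<lambda>E. pick_class k S E = U) * (1 - mu p))"
  proof (rule sum.cong[OF refl])
    fix U assume "U \<in> I"
    then have U: "U \<subseteq> S" "card U = k" by (auto simp: I_def)
    have Un: "U \<subseteq> {..<n}" "x \<notin> U" using U assms by auto
    have "prob (\<lambda>E. card (nbrs E x U) = 1) = mu p"
      using prob_card_nbrs_eq_1[OF assms(1) Un] mu_eq(2)[OF p_pos p_less_1] U(2) k by simp
    then have "prob (\<lambda>E. card (nbrs E x U) \<noteq> 1) = 1 - mu p" unfolding prob_Not by simp
    moreover have "prob (\<lambda>E. pick_class k S E = U \<and> card (nbrs E x U) \<noteq> 1)
      = prob (\<lambda>E. pick_class k S E = U) * prob (\<lambda>E. card (nbrs E x U) \<noteq> 1)"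
    proof (rule prob_conj)
      show "pairs S \<subseteq> vertex_pairs n" unfolding vertex_pairs_eq using assms(2) by (rule pairs_mono)
      show "star x U \<subseteq> vertex_pairs n" using assms(1) Un by (intro star_subset_vertex_pairs)
      show "pairs S \<inter> star x U = {}" using assms(3) by (auto simp: pairs_def star_def)
      show "depends_on (pairs S) (\<lambda>E. pick_class k S E = U)"
      proof (rule depends_onI)
        fix E E' assume "E \<inter> pairs S = E' \<inter> pairs S"
        from pick_class_cong[OF this, of k]
        show "(pick_class k S E = U) = (pick_class k S E' = U)" by simp
      qed
      show "depends_on (star x U) (\<lambda>E. card (nbrs E x U) \<noteq> 1)" by (rule depends_on_nbrs)
    qed
    ultimately show "prob (\<lambda>E. pick_class k S E = U \<and> card (nbrs E x U) \<noteq> 1)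
      = prob (\<lambda>E. pick_class k S E = U) * (1 - mu p)" by simp
  qed
  also have "\<dots> = (\<Sum>U\<in>I. prob (\<lambda>E. pick_class k S E = U)) * (1 - mu p)"
    by (rule sum_distrib_right[symmetric])
  also have "(\<Sum>U\<in>I. prob (\<lambda>E. pick_class k S E = U)) = prob (\<lambda>E. \<exists>U\<in>I. pick_class k S E = U)"
    by (rule prob_ex_disjoint[OF finI, symmetric]) simp
  also have "\<dots> = 1" using pick by simp
  finally show ?thesis by simp
qed

text \<open>For each block the event reads only \<open>pairs (S i) \<union> star x (S i)\<close>,
  and disjoint blocks make these coordinate sets disjoint. In contrast to
  \<open>prob_no_unique_class\<close>, equality holds because all classes have the optimal
  size.\<close>

lemma prob_no_pick_class:
  assumes "x < n" "finite I" "disjoint_family_on S I" "k = nat \<lfloor>1 / p\<rfloor>"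
    and S: "\<And>i. i \<in> I \<Longrightarrow> S i \<subseteq> {..<n} - {x}" "\<And>i. i \<in> I \<Longrightarrow> k \<le> card (S i)"
  shows "prob (\<lambda>E. \<forall>i\<in>I. card (nbrs E x (pick_class k (S i) E)) \<noteq> 1) = (1 - mu p) ^ card I"
proof -
  have "prob (\<lambda>E. \<forall>i\<in>I. card (nbrs E x (pick_class k (S i) E)) \<noteq> 1)
    = (\<Prod>i\<in>I. prob (\<lambda>E. card (nbrs E x (pick_class k (S i) E)) \<noteq> 1))"
  proof (rule prob_ball[where D = "\<lambda>i. pairs (S i) \<union> star x (S i)"])
    fix i assume i: "i \<in> I"
    then have Si: "S i \<subseteq> {..<n}" "x \<notin> S i" using S by auto
    show "pairs (S i) \<union> star x (S i) \<subseteq> vertex_pairs n"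
      using pairs_mono[OF Si(1)] star_subset_vertex_pairs[OF assms(1) Si] by (simp add: vertex_pairs_eq)
    show "depends_on (pairs (S i) \<union> star x (S i)) (\<lambda>E. card (nbrs E x (pick_class k (S i) E)) \<noteq> 1)"
    proof (rule depends_onI)
      fix E E' assume eq: "E \<inter> (pairs (S i) \<union> star x (S i)) = E' \<inter> (pairs (S i) \<union> star x (S i))"
      then have "E \<inter> pairs (S i) = E' \<inter> pairs (S i)" by blast
      then have pc: "pick_class k (S i) E = pick_class k (S i) E'" by (rule pick_class_cong)
      have "pick_class k (S i) E' \<subseteq> S i" using S(2)[OF i] by (rule pick_class)
      then have "nbrs E x (pick_class k (S i) E') = nbrs E' x (pick_class k (S i) E')"
        using eq by (auto simp: nbrs_def star_def)
      then show "(card (nbrs E x (pick_class k (S i) E)) \<noteq> 1) = (card (nbrs E' x (pick_class k (S i) E')) \<noteq> 1)"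
        by (simp add: pc)
    qed
    fix j assume j: "j \<in> I" "i \<noteq> j"
    then have dis: "S i \<inter> S j = {}" using i assms(3) by (auto simp: disjoint_family_on_def)
    have "pairs (S i) \<inter> pairs (S j) = {}"
    proof -
      have False if "e \<in> pairs (S i) \<inter> pairs (S j)" for e
      proof -
        have "e \<subseteq> S i \<inter> S j" "card e = 2" using that by (auto simp: pairs_def)
        then show False using dis by simp
      qed
      then show ?thesis by blast
    qed
    moreover have "star x (S i) \<inter> star x (S j) = {}" using dis by (rule star_disjoint')
    moreover have "pairs (S i) \<inter> star x (S j) = {}" "star x (S i) \<inter> pairs (S j) = {}"
      using Si(2) S(1)[OF j(1)] by (auto simp: pairs_def star_def)
    ultimately show "(pairs (S i) \<union> star x (S i)) \<inter> (pairs (S j) \<union> star x (S j)) = {}" by blast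
  qed (rule assms(2))
  also have "\<dots> = (\<Prod>i\<in>I. 1 - mu p)"
  proof (rule prod.cong[OF refl])
    fix i assume "i \<in> I"
    then show "prob (\<lambda>E. card (nbrs E x (pick_class k (S i) E)) \<noteq> 1) = 1 - mu p"
      using S assms(1,4) by (intro prob_pick_class) auto
  qed
  finally show ?thesis by simp
qed

end

section \<open>The upper bound\<close>

lemma chi_CF_le:
  fixes c :: "'a \<Rightarrow> nat"
  assumes "c ` V \<subseteq> {..<r}" "conflict_free V E c"
  shows "chi_CF V E \<le> r"
  unfolding chi_CF_def using assms by (intro Least_le) blast

text \<open>Class \<open>U i\<close> gets colour \<open>i\<close>, remaining vertices of
  \<open>W\<close> get \<open>R + d x\<close>, and all others the dummy \<open>R + s\<close>.
  Vertices of the first two kinds are their own witnesses; the others use their single neighbour in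
  some class.\<close>

lemma chi_CF_le_independent_classes:
  fixes E :: "nat set set"
  assumes U: "\<And>i. i < R \<Longrightarrow> U i \<subseteq> {..<n}" "\<And>i. i < R \<Longrightarrow> indep E (U i)" "disjoint_family_on U {..<R}"
    and d: "d ` W \<subseteq> {..<s}" "\<forall>x\<in>W. \<forall>y\<in>W. x \<noteq> y \<longrightarrow> {x, y} \<in> E \<longrightarrow> d x \<noteq> d y"
    and uniq: "\<And>x. x < n \<Longrightarrow> x \<notin> W \<Longrightarrow> \<exists>i<R. card (nbrs E x (U i)) = 1"
  shows "chi_CF {..<n} E \<le> R + s + 1"
proof (rule chi_CF_le)
  define ix where "ix x = (THE i. i < R \<and> x \<in> U i)" for x
  have ix: "ix x = i" if "i < R" "x \<in> U i" for x i
    unfolding ix_def using that U(3) by (intro the_equality) (auto simp: disjoint_family_on_def)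
  \<comment> \<open>Classes take precedence: a vertex of \<open>W\<close> inside a class keeps the
    class colour.\<close>
  define c where "c x = (if \<exists>i<R. x \<in> U i then ix x else if x \<in> W then R + d x else R + s)" for x
  have cU: "c x = i" if "i < R" "x \<in> U i" for x i
    using ix[OF that] that by (auto simp: c_def)
  have cU': "x \<in> U i" if "c x = i" "i < R" for x i
  proof -
    have "\<exists>i<R. x \<in> U i" using that by (auto simp: c_def split: if_splits)
    then obtain j where "j < R" "x \<in> U j" by blast
    then show ?thesis using cU[of j x] that by simp
  qed
  show "c ` {..<n} \<subseteq> {..<R + s + 1}"
  proof (intro subsetI, elim imageE)
    fix y x assume "y = c x"
    moreover have "d x < s" if "x \<in> W" using d(1) that by auto
    ultimately show "y \<in> {..<R + s + 1}" using ix by (auto simp: c_def)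
  qed
  show "conflict_free {..<n} E c"
    unfolding conflict_free_def
  proof
    fix x assume "x \<in> {..<n}"
    then have xn: "x < n" by simp
    consider (coloured) i where "i < R" "x \<in> U i" | (left) "\<forall>i<R. x \<notin> U i" "x \<in> W" | (other) "\<forall>i<R. x \<notin> U i" "x \<notin> W"
      by blast
    then show "\<exists>y\<in>closed_nbhd {..<n} E x. \<forall>z\<in>closed_nbhd {..<n} E x. z \<noteq> y \<longrightarrow> c z \<noteq> c y"
    proof cases
      case coloured
      have "c z \<noteq> c x" if "z \<in> closed_nbhd {..<n} E x" "z \<noteq> x" for z
      proof
        assume "c z = c x"
        then have "z \<in> U i" using cU'[of z i] cU[OF coloured] coloured by simp
        then show False using U(2)[OF coloured(1)] coloured(2) that by (auto simp: indep_def closed_nbhd_def nbhd_def)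
      qed
      then show ?thesis by (intro bexI[of _ x]) (auto simp: closed_nbhd_def)
    next
      case left
      have cx: "c x = R + d x" using left by (auto simp: c_def)
      have "c z \<noteq> c x" if z: "z \<in> closed_nbhd {..<n} E x" "z \<noteq> x" for z
      proof
        assume eq: "c z = c x"
        \<comment> \<open>This separates the colour of \<open>x\<close> from the dummy colour
          \<open>R + s\<close>.\<close>
        have "d x < s" using d(1) left(2) by auto
        have "\<not> (\<exists>i<R. z \<in> U i)"
        proof
          assume "\<exists>i<R. z \<in> U i"
          then obtain i where "i < R" "z \<in> U i" by blast
          then show False using cU[of i z] eq cx by simp
        qed
        then have "z \<in> W \<and> d z = d x"
          using eq cx \<open>d x < s\<close> by (simp add: c_def split: if_splits)
        moreover have "{x, z} \<in> E" using z by (auto simp: closed_nbhd_def nbhd_def)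
        ultimately show False using d(2) left(2) z(2) by (metis)
      qed
      then show ?thesis by (intro bexI[of _ x]) (auto simp: closed_nbhd_def)
    next
      case other
      obtain i where i: "i < R" "card (nbrs E x (U i)) = 1" using uniq[OF xn other(2)] by blast
      then obtain y where y: "nbrs E x (U i) = {y}" by (auto simp: card_1_singleton_iff)
      then have yU: "y \<in> U i" "{x, y} \<in> E" by (auto simp: nbrs_def)
      have yN: "y \<in> closed_nbhd {..<n} E x" using yU U(1)[OF i(1)] by (auto simp: closed_nbhd_def nbhd_def)
      have "c z \<noteq> c y" if z: "z \<in> closed_nbhd {..<n} E x" "z \<noteq> y" for z
      proof
        assume "c z = c y"
        then have zU: "z \<in> U i" using cU'[of z i] cU[OF i(1) yU(1)] i(1) by simp
        \<comment> \<open>\<open>x\<close> carries no class colour, so \<open>z\<close> is in the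
          closed neighbourhood as a true neighbour.\<close>
        then have "z \<noteq> x" using other(1) i(1) by auto
        then have "z \<in> nbrs E x (U i)" using z(1) zU by (auto simp: nbrs_def closed_nbhd_def nbhd_def)
        then show False using y z(2) by simp
      qed
      then show ?thesis using yN by blast
    qed
  qed
qed

text \<open>The first \<open>r\<close> classes, chosen inside the vertices below \<open>r * m\<close>, serve all vertices outside
  this set; the other \<open>r'\<close> classes serve the vertices inside it. This way each vertex is tested only
  against classes whose choice is independent of the edges leaving that vertex.\<close>

lemma (in gnp_graph) prob_chi_CF_gt_le:
  assumes k: "k = nat \<lfloor>1 / p\<rfloor>" and "1 \<le> b" "1 \<le> \<sigma>" "1 \<le> n" and fit: "(r + r') * (k * b) \<le> n"
    and y: "real b * exp 1 * (1 - (1 - p) ^ (k - 1)) ^ (b - 1) \<le> 1"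
    and z: "exp 1 * (real n * p) * (exp 1 / (2 * real \<sigma>)) ^ \<sigma> \<le> 1 / 2"
  shows "prob (\<lambda>E. r + r' + 2 * \<sigma> + 1 < chi_CF {..<n} E)
    \<le> real (r + r') * (real b * exp 1 * (1 - (1 - p) ^ (k - 1)) ^ (b - 1))
      + p * (real n * (1 - mu p) ^ r + real (r * (k * b)) * (1 - mu p) ^ r')
      + 2 * (exp 1 * (real n * p) * (exp 1 / (2 * real \<sigma>)) ^ \<sigma>)"
proof -
  define m where "m = k * b"
  define R where "R = r + r'"
  have k1: "1 \<le> k" using mu_eq(1)[OF p_pos p_less_1] k by simp
  \<comment> \<open>Consecutive blocks of \<open>m\<close> vertices; the first \<open>r\<close> of
    them fill \<open>{..<r * m}\<close>.\<close>
  define S where "S i = {i * m..<Suc i * m}" for i :: nat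
  define U where "U i E = pick_class k (S i) E" for i E
  have S_mono: "S i \<subseteq> {..<j * m}" if "i < j" for i j
    using mult_le_mono1[of "Suc i" j m] that by (auto simp: S_def)
  have S_above: "S i \<inter> {..<j * m} = {}" if "j \<le> i" for i j
  proof -
    have "j * m \<le> i * m" using that by (rule mult_le_mono1)
    moreover have "i * m \<le> x" if "x \<in> S i" for x using that by (simp add: S_def)
    ultimately show ?thesis by (meson disjoint_iff lessThan_iff not_le order_trans)
  qed
  have Sn: "S i \<subseteq> {..<n}" if "i < R" for i
    using S_mono[OF that] fit by (auto simp: R_def m_def)
  have cardS: "card (S i) = k * b" for i by (simp add: S_def m_def)
  have kS: "k \<le> card (S i)" for i unfolding cardS using assms(2) by simp
  have Sdisj: "disjoint_family_on S I" for I
    unfolding disjoint_family_on_def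
  proof (intro ballI impI)
    fix i j :: nat assume "i \<noteq> j"
    then show "S i \<inter> S j = {}"
      using S_mono[of i j] S_above[of j j] S_mono[of j i] S_above[of i i] by (cases "i < j") force+
  qed
  have U: "U i E \<subseteq> S i" "card (U i E) = k" for i E using pick_class[OF kS] by (auto simp: U_def)
  have Udisj: "disjoint_family_on (\<lambda>i. U i E) {..<R}" for E
    using Sdisj[of "{..<R}"] U(1) unfolding disjoint_family_on_def by blast
  \<comment> \<open>\<open>x\<close> is left unserved by the family of classes responsible for
    it.\<close>
  define F where "F x E \<longleftrightarrow> (if x < r * m then \<forall>i\<in>{r..<R}. card (nbrs E x (U i E)) \<noteq> 1
    else \<forall>i\<in>{..<r}. card (nbrs E x (U i E)) \<noteq> 1)" for x E
  \<comment> \<open>Three bad events. The threshold \<open>1 / p\<close> in \<open>B2\<close>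
    matches the size bound in \<open>B3\<close>, so when both fail the unserved vertices induce a
    degenerate graph.\<close>
  define B1 where "B1 i E \<longleftrightarrow> \<not> (\<exists>U\<subseteq>S i. card U = k \<and> indep E U)" for i E
  define B2 where "B2 E \<longleftrightarrow> 1 / p < real (card {x \<in> {..<n}. F x E})" for E
  define B3 where "B3 E \<longleftrightarrow> (\<exists>T. T \<subseteq> {..<n} \<and> T \<noteq> {} \<and> real (card T) * p \<le> 1 \<and> (\<forall>x\<in>T. 2 * \<sigma> \<le> card (nbrs E x T)))" for E
  have "prob (\<lambda>E. R + 2 * \<sigma> + 1 < chi_CF {..<n} E) \<le> prob (\<lambda>E. ((\<exists>i\<in>{..<R}. B1 i E) \<or> B2 E) \<or> B3 E)"
  proof (rule prob_mono)
    fix E assume chi: "R + 2 * \<sigma> + 1 < chi_CF {..<n} E"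
    show "((\<exists>i\<in>{..<R}. B1 i E) \<or> B2 E) \<or> B3 E"
    proof (rule ccontr)
      assume "\<not> (((\<exists>i\<in>{..<R}. B1 i E) \<or> B2 E) \<or> B3 E)"
      then have nB1: "\<And>i. i < R \<Longrightarrow> \<not> B1 i E" and nB2: "\<not> B2 E" and nB3: "\<not> B3 E" by auto
      define W where "W = {x \<in> {..<n}. F x E}"
      have finW: "finite W" by (simp add: W_def)
      have "\<exists>d :: nat \<Rightarrow> nat. d ` W \<subseteq> {..<2 * \<sigma>} \<and> (\<forall>x\<in>W. \<forall>y\<in>W. x \<noteq> y \<longrightarrow> {x, y} \<in> E \<longrightarrow> d x \<noteq> d y)"
      proof (rule degenerate_colouring[OF finW])
        fix T assume T: "T \<subseteq> W" "T \<noteq> {}"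
        have "real (card T) \<le> real (card W)" using card_mono[OF finW T(1)] by simp
        also have "\<dots> \<le> 1 / p" using nB2 by (simp add: B2_def W_def)
        finally have "real (card T) * p \<le> 1" using p_pos by (simp add: field_simps)
        moreover have "T \<subseteq> {..<n}" using T(1) by (auto simp: W_def)
        ultimately show "\<exists>x\<in>T. card (nbrs E x T) < 2 * \<sigma>"
          using nB3 T(2) unfolding B3_def by (meson not_le)
      qed
      then obtain d :: "nat \<Rightarrow> nat" where d: "d ` W \<subseteq> {..<2 * \<sigma>}"
        "\<forall>x\<in>W. \<forall>y\<in>W. x \<noteq> y \<longrightarrow> {x, y} \<in> E \<longrightarrow> d x \<noteq> d y" by (elim exE conjE) (rule that)
      have "chi_CF {..<n} E \<le> R + 2 * \<sigma> + 1"
      proof (rule chi_CF_le_independent_classes[where U = "\<lambda>i. U i E" and d = d and W = W])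
        fix i assume i: "i < R"
        show "U i E \<subseteq> {..<n}" using U(1) Sn[OF i] by (rule order_trans)
        show "indep E (U i E)" unfolding U_def
          using nB1[OF i] by (intro pick_class(3)[OF kS]) (simp only: B1_def not_not)
      next
        fix x assume "x < n" "x \<notin> W"
        then have "\<not> F x E" by (simp add: W_def)
        then have "\<exists>i\<in>{r..<R} \<union> {..<r}. card (nbrs E x (U i E)) = 1"
          unfolding F_def by (meson UnI1 UnI2)
        then obtain i where "i \<in> {r..<R} \<union> {..<r}" "card (nbrs E x (U i E)) = 1" by blast
        then show "\<exists>i<R. card (nbrs E x (U i E)) = 1"
          by (intro exI[of _ i]) (auto simp: R_def)
      qed (use d Udisj in auto)
      then show False using chi by simp
    qed
  qed
  also have "\<dots> \<le> prob (\<lambda>E. (\<exists>i\<in>{..<R}. B1 i E) \<or> B2 E) + prob B3"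
    by (rule prob_disj_le)
  also have "prob (\<lambda>E. (\<exists>i\<in>{..<R}. B1 i E) \<or> B2 E) \<le> prob (\<lambda>E. \<exists>i\<in>{..<R}. B1 i E) + prob B2"
    by (rule prob_disj_le)
  also have "prob (\<lambda>E. \<exists>i\<in>{..<R}. B1 i E) \<le> real (card {..<R}) * (real b * exp 1 * (1 - (1 - p) ^ (k - 1)) ^ (b - 1))"
  proof (rule prob_union_bound)
    fix i assume "i \<in> {..<R}"
    then show "prob (B1 i) \<le> real b * exp 1 * (1 - (1 - p) ^ (k - 1)) ^ (b - 1)"
      unfolding B1_def using Sn cardS k1 assms(2) y by (intro prob_no_indep_le) auto
  qed simp
  \<comment> \<open>Markov with threshold \<open>1 / p\<close> is the source of the factor
    \<open>p\<close> in the bound.\<close>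
  also have "prob B2 \<le> (\<Sum>x\<in>{..<n}. prob (F x)) / (1 / p)"
    unfolding B2_def using p_pos by (intro markov_card) auto
  also have "(\<Sum>x\<in>{..<n}. prob (F x)) = (\<Sum>x\<in>{..<n}. if x < r * m then (1 - mu p) ^ r' else (1 - mu p) ^ r)"
  proof (rule sum.cong[OF refl])
    fix x assume "x \<in> {..<n}"
    then have xn: "x < n" by simp
    show "prob (F x) = (if x < r * m then (1 - mu p) ^ r' else (1 - mu p) ^ r)"
    proof (cases "x < r * m")
      case True
      have "prob (\<lambda>E. \<forall>i\<in>{r..<R}. card (nbrs E x (pick_class k (S i) E)) \<noteq> 1) = (1 - mu p) ^ card {r..<R}"
      proof (rule prob_no_pick_class)
        fix i assume "i \<in> {r..<R}"
        then show "S i \<subseteq> {..<n} - {x}" using Sn[of i] S_above[of r i] True by auto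
      qed (use xn k kS Sdisj in auto)
      then show ?thesis using True by (simp add: F_def U_def R_def)
    next
      case False
      have "prob (\<lambda>E. \<forall>i\<in>{..<r}. card (nbrs E x (pick_class k (S i) E)) \<noteq> 1) = (1 - mu p) ^ card {..<r}"
      proof (rule prob_no_pick_class)
        fix i assume "i \<in> {..<r}"
        then show "S i \<subseteq> {..<n} - {x}" using Sn[of i] S_mono[of i r] False by (auto simp: R_def)
      qed (use xn k kS Sdisj in auto)
      then show ?thesis using False by (simp add: F_def U_def)
    qed
  qed
  also have "\<dots> \<le> real n * (1 - mu p) ^ r + real (r * m) * (1 - mu p) ^ r'"
  proof -
    have "(\<Sum>x\<in>{..<n}. if x < r * m then (1 - mu p) ^ r' else (1 - mu p) ^ r)
      \<le> (\<Sum>x\<in>{..<n}. (if x < r * m then (1 - mu p) ^ r' else 0) + (1 - mu p) ^ r)"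
      using mu_less_1 by (intro sum_mono) auto
    also have "\<dots> = (\<Sum>x\<in>{..<n} \<inter> {x. x < r * m}. (1 - mu p) ^ r') + real n * (1 - mu p) ^ r"
      by (simp add: sum.distrib sum.If_cases)
    also have "(\<Sum>x\<in>{..<n} \<inter> {x. x < r * m}. (1 - mu p) ^ r') \<le> real (r * m) * (1 - mu p) ^ r'"
    proof -
      have "card ({..<n} \<inter> {x. x < r * m}) \<le> card {..<r * m}" by (rule card_mono) auto
      then have "real (card ({..<n} \<inter> {x. x < r * m})) \<le> real (r * m)" by (simp only: card_lessThan of_nat_le_iff)
      then show ?thesis using mu_less_1 unfolding sum_constant by (intro mult_right_mono) auto
    qed
    finally show ?thesis by simp
  qed
  also have "prob B3 \<le> 2 * (exp 1 * (real n * p) * (exp 1 / (2 * real \<sigma>)) ^ \<sigma>)"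
    unfolding B3_def using assms(3,4) z by (rule prob_dense_subset_le)
  finally show ?thesis using p_pos by (simp add: R_def m_def mult.commute divide_right_mono)
qed

section \<open>Asymptotics\<close>

context gnp_graph
begin

text \<open>All rests on \<open>k \<le> 1 / p < k + 1 \<le> 2 * k\<close>. The last bound multiplies
  \<open>- ln (1 - p) \<le> p / (1 - p)\<close> by \<open>k - 1 \<le> 1 / p - 1\<close>; the two
  right-hand sides cancel to 1.\<close>

lemma floor_inverse_bounds:
  assumes k: "k = nat \<lfloor>1 / p\<rfloor>"
  shows "1 \<le> k" "real k * p \<le> 1" "1 / 2 \<le> real k * p" "exp (-1) \<le> (1 - p) ^ (k - 1)"
proof -
  show k1: "1 \<le> k" using mu_eq(1)[OF p_pos p_less_1] k by simp
  have rk: "real k = of_int \<lfloor>1 / p\<rfloor>"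
    using k1 k by simp
  have le: "real k \<le> 1 / p" unfolding rk by (rule of_int_floor_le)
  then show "real k * p \<le> 1" using p_pos by (simp add: field_simps)
  have "1 / p < real k + 1" unfolding rk using floor_correct[of "1 / p"] by simp
  also have "\<dots> \<le> 2 * real k" using k1 by simp
  finally show "1 / 2 \<le> real k * p" using p_pos by (simp add: field_simps)
  have "ln (1 / (1 - p)) \<le> 1 / (1 - p) - 1" using p_less_1 by (intro ln_le_minus_one) simp
  then have "- ln (1 - p) \<le> p / (1 - p)" using p_less_1 by (simp add: ln_div field_simps)
  then have "real (k - 1) * - ln (1 - p) \<le> (1 / p - 1) * (p / (1 - p))"
    using le k1 p_pos p_less_1 by (intro mult_mono) (auto simp: of_nat_diff)
  also have "\<dots> = 1" using p_pos p_less_1 by (simp add: field_simps)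
  finally have "-1 \<le> real (k - 1) * ln (1 - p)" by simp
  then have "exp (-1) \<le> exp (real (k - 1) * ln (1 - p))" by simp
  also have "\<dots> = (1 - p) ^ (k - 1)" using p_less_1 by (simp add: exp_of_nat_mult)
  finally show "exp (-1) \<le> (1 - p) ^ (k - 1)" .
qed

text \<open>\<open>mu p\<close> is at least \<open>1 / 2 * (1 / 3)\<close>, and
  \<open>- ln (1 - x) \<ge> x\<close>. Hence the ratio \<open>L\<close> in the estimates below is at
  most \<open>6 * l\<close>.\<close>

lemma neg_ln_mu_ge: "1 / 6 \<le> - ln (1 - mu p)"
proof -
  define k where "k = nat \<lfloor>1 / p\<rfloor>"
  note k = floor_inverse_bounds[OF k_def]
  have "1 / 3 \<le> exp (-1 :: real)" using exp_le by (simp add: exp_minus field_simps)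
  then have "1 / 2 * (1 / 3) \<le> real k * p * (1 - p) ^ (k - 1)"
    using k(3,4) p_pos by (intro mult_mono) auto
  also have "\<dots> = mu p" using mu_eq(2)[OF p_pos p_less_1] by (simp add: k_def)
  also have "\<dots> \<le> - ln (1 - mu p)" using ln_le_minus_one[of "1 - mu p"] mu_less_1 by simp
  finally show ?thesis by simp
qed

text \<open>The distance of \<open>p\<close> from 1 enters here:
  \<open>1 - mu p \<ge> (1 - p) ^ k\<close>, where one factor is at least \<open>\<epsilon>\<close>
  and the others together at least \<open>exp (-1)\<close>.\<close>

lemma neg_ln_mu_le:
  assumes "0 < \<epsilon>" "p \<le> 1 - \<epsilon>"
  shows "- ln (1 - mu p) \<le> 1 - ln \<epsilon>"
proof -
  define k where "k = nat \<lfloor>1 / p\<rfloor>"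
  note k = floor_inverse_bounds[OF k_def]
  have "\<epsilon> * exp (-1) \<le> (1 - p) * (1 - p) ^ (k - 1)"
    using k(4) assms p_less_1 by (intro mult_mono) auto
  also have "\<dots> = (1 - p) ^ k" using k(1) by (cases k) auto
  also have "\<dots> \<le> 1 - mu p" using mu_le by (simp add: k_def)
  finally have "ln (\<epsilon> * exp (-1)) \<le> ln (1 - mu p)" using assms mu_less_1 by simp
  then show ?thesis using assms by (simp add: ln_mult)
qed

lemma power_mu: "(1 - mu p) ^ r = exp (- (- ln (1 - mu p) * real r))"
  using mu_less_1 by (simp add: mult.commute exp_of_nat_mult)

text \<open>\<open>prob_conflict_free_le\<close> with the size limit \<open>t\<close> of about
  \<open>4 * l / p\<close>; the two summands estimate its two union bounds. The assumptions on
  \<open>l\<close> hold for all large \<open>l\<close>.\<close>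

lemma prob_chi_CF_less_le:
  assumes "0 < \<epsilon>" "\<epsilon> < 1"
  defines "l \<equiv> ln (real n * p)"
  assumes l: "1 \<le> l" "(4 * l + 2) * 3 \<le> exp l" "36 * l * (4 * l + 1) \<le> exp l"
    and G: "6 * l * (3 * l * (4 * l + 1) + 1) + 1 - exp (\<epsilon> * l) / 2 \<le> 0"
  shows "prob (\<lambda>E. real (chi_CF {..<n} E) < (1 - \<epsilon>) * (l / (- ln (1 - mu p))))
    \<le> exp (2 - 4 * l\<^sup>2) + exp (6 * l * (3 * l * (4 * l + 1) + 1) + 1 - exp (\<epsilon> * l) / 2)"
proof -
  define c0 where "c0 = - ln (1 - mu p)"
  define L where "L = l / c0"
  define t where "t = nat \<lceil>4 * l / p\<rceil>"
  define r where "r = nat \<lfloor>(1 - \<epsilon>) * L\<rfloor>"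
  define G' where "G' = 6 * l * (3 * l * (4 * l + 1) + 1) + 1 - exp (\<epsilon> * l) / 2"
  \<comment> \<open>For \<open>n = 0\<close> the default \<open>ln 0 = 0\<close> contradicts
    \<open>1 \<le> l\<close>.\<close>
  have np0: "0 < real n * p" using l(1) p_pos unfolding l_def by (cases n) auto
  have np: "real n * p = exp l" using np0 by (simp add: l_def)
  have c0: "1 / 6 \<le> c0" using neg_ln_mu_ge by (simp add: c0_def)
  have L: "0 \<le> L" "L \<le> 6 * l"
    using c0 l(1) by (auto simp: L_def field_simps)
  have t: "4 * l / p \<le> real t" "real t \<le> 4 * l / p + 1"
  proof -
    have "0 \<le> 4 * l / p" using l(1) p_pos by simp
    then show "4 * l / p \<le> real t" "real t \<le> 4 * l / p + 1" unfolding t_def by linarith+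
  qed
  have tp: "4 * l \<le> real t * p" "real t * p \<le> 4 * l + p"
    using t p_pos by (auto simp: field_simps)
  have t1: "1 \<le> t"
  proof -
    have "0 < 4 * l / p" using l(1) p_pos by simp
    then show ?thesis using t(1) by linarith
  qed
  have rL: "real r \<le> (1 - \<epsilon>) * L" unfolding r_def using L assms(2) by simp
  have "(1 - \<epsilon>) * L \<le> L" using L(1) assms(1) by (simp add: algebra_simps)
  then have r6: "real r \<le> 6 * l" using rL L by linarith
  have rtp: "real r * real t * p \<le> 6 * l * (4 * l + 1)"
  proof -
    have "real r * (real t * p) \<le> 6 * l * (4 * l + 1)"
      using r6 tp(2) p_less_1 p_pos l(1) by (intro mult_mono) auto
    then show ?thesis by (simp add: mult.assoc)
  qed
  \<comment> \<open>At least half of the vertices survive the removal of \<open>3 * r * t\<close>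
    vertices.\<close>
  have half: "3 * (real r * real t) \<le> real n / 2"
  proof -
    have "3 * (real r * real t) * p \<le> real n / 2 * p" using rtp l(3) np by simp
    then show ?thesis using p_pos by (simp only: mult_le_cancel_right_pos)
  qed
  have "real (3 * r * t) = 3 * (real r * real t)" by simp
  with half have "real (3 * r * t) \<le> real n" by linarith
  then have fit: "3 * r * t \<le> n" by (simp only: of_nat_le_iff)
  \<comment> \<open>As \<open>t * p \<ge> 4 * l\<close>, the power of \<open>1 - p\<close> is at
    most \<open>exp (1 - 4 * l)\<close>; one factor \<open>exp l\<close> absorbs
    \<open>3 * (4 * l + 2)\<close>.\<close>
  have \<beta>: "(1 - p) ^ t + real t * p * (1 - p) ^ (t - 1) \<le> exp (- 3 * l)"
  proof -
    have "(1 - p) ^ t \<le> (1 - p) ^ (t - 1)" using p_pos p_less_1 by (intro power_decreasing) auto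
    then have "(1 - p) ^ t + real t * p * (1 - p) ^ (t - 1) \<le> (1 + real t * p) * (1 - p) ^ (t - 1)"
      by (simp add: algebra_simps)
    also have "\<dots> \<le> (4 * l + 2) * (1 - p) ^ (t - 1)"
      using tp p_less_1 by (intro mult_right_mono) auto
    also have "(1 - p) ^ (t - 1) \<le> exp (- p) ^ (t - 1)"
      using p_less_1 exp_ge_add_one_self[of "- p"] by (intro power_mono) auto
    also have "exp (- p) ^ (t - 1) = exp (- (real (t - 1) * p))"
      by (simp flip: exp_of_nat_mult)
    also have "\<dots> \<le> exp (1 - 4 * l)"
      using tp t1 p_less_1 by (simp add: of_nat_diff algebra_simps)
    also have "\<dots> = exp 1 * exp (- 4 * l)" by (simp flip: exp_add)
    also have "\<dots> \<le> 3 * exp (- 4 * l)" by (intro mult_right_mono exp_le) simp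
    also have "(4 * l + 2) * (3 * exp (- 4 * l)) = (4 * l + 2) * 3 * exp (- 4 * l)" by simp
    also have "\<dots> \<le> exp l * exp (- 4 * l)" using l(2) by (intro mult_right_mono) auto
    also have "\<dots> = exp (- 3 * l)" by (simp flip: exp_add)
    finally show ?thesis using l(1) by (simp add: mult_left_mono)
  qed
  define N where "N s = (real n * p) ^ s * exp (1 / p)" for s
  have N: "N s = exp (real s * l + 1 / p)" for s
    unfolding N_def np by (simp add: exp_add exp_of_nat_mult)
  have main: "prob (\<lambda>E. \<exists>c :: nat \<Rightarrow> nat. c ` {..<n} \<subseteq> {..<r} \<and> conflict_free {..<n} E c)
    \<le> N t * N t * exp (- 3 * l) ^ t + N t ^ r * N (2 * r * t) * (1 - (1 - mu p) ^ r) ^ (n - 3 * r * t)"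
    unfolding N_def using l(1) np fit \<beta> by (intro prob_conflict_free_le) auto
  \<comment> \<open>Both final exponents have the form \<open>x / p\<close> with
    \<open>x \<le> 0\<close>; as \<open>p < 1\<close>, dropping the division weakens the bound and
    makes it uniform in \<open>p\<close>.\<close>
  have scale: "exp (x / p) \<le> exp x" if "x \<le> 0" for x
    using that p_pos p_less_1 by (simp add: divide_le_eq mult_le_cancel_left1)
  have "N t * N t * exp (- 3 * l) ^ t = exp (2 / p - real t * l)"
    unfolding N by (simp flip: exp_add exp_of_nat_mult)
  also have "\<dots> \<le> exp ((2 - 4 * l\<^sup>2) / p)"
    using mult_right_mono[OF t(1), of l] l(1) by (simp add: diff_divide_distrib power2_eq_square mult_ac)
  also have "\<dots> \<le> exp (2 - 4 * l\<^sup>2)"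
  proof (rule scale)
    have "1 \<le> l\<^sup>2" using l(1) by simp
    then show "2 - 4 * l\<^sup>2 \<le> 0" by simp
  qed
  finally have term1: "N t * N t * exp (- 3 * l) ^ t \<le> exp (2 - 4 * l\<^sup>2)" .
  define \<pi> where "\<pi> = (1 - mu p) ^ r"
  have \<pi>: "exp (- (1 - \<epsilon>) * l) \<le> \<pi>"
  proof -
    have "c0 * real r \<le> (1 - \<epsilon>) * l" using mult_left_mono[OF rL, of c0] c0 by (simp add: L_def mult_ac)
    then show ?thesis unfolding \<pi>_def power_mu c0_def by (simp add: algebra_simps)
  qed
  have \<pi>1: "\<pi> \<le> 1" "0 \<le> \<pi>" unfolding \<pi>_def using mu_less_1 mu_pos by (auto intro: power_le_one)
  have "(1 - \<pi>) ^ (n - 3 * r * t) \<le> exp (- \<pi>) ^ (n - 3 * r * t)"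
    using \<pi>1 exp_ge_add_one_self[of "- \<pi>"] by (intro power_mono) auto
  also have "\<dots> = exp (- (real (n - 3 * r * t) * \<pi>))"
    by (simp flip: exp_of_nat_mult)
  also have "\<dots> \<le> exp (- (exp (\<epsilon> * l) / 2 / p))"
  proof -
    \<comment> \<open>Half of \<open>n = exp l / p\<close> vertices, each unserved with probability
      at least \<open>exp (- (1 - \<epsilon>) * l)\<close>; the resulting
      \<open>exp (\<epsilon> * l)\<close> beats the polynomial in \<open>l\<close> from the
      counting.\<close>
    have "exp (\<epsilon> * l) / 2 / p = real n / 2 * exp (- (1 - \<epsilon>) * l)"
    proof -
      have "exp (\<epsilon> * l) = exp l * exp (- (1 - \<epsilon>) * l)" by (simp add: algebra_simps flip: exp_add)
      then show ?thesis using p_pos by (simp flip: np)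
    qed
    also have "\<dots> \<le> real (n - 3 * r * t) * \<pi>"
      using half fit \<pi> by (intro mult_mono) (auto simp: of_nat_diff mult.assoc)
    finally show ?thesis by simp
  qed
  finally have "N t ^ r * N (2 * r * t) * (1 - \<pi>) ^ (n - 3 * r * t)
    \<le> N t ^ r * N (2 * r * t) * exp (- (exp (\<epsilon> * l) / 2 / p))"
    by (intro mult_left_mono) (auto simp: N)
  also have "\<dots> = exp (real r * (real t * l + 1 / p) + (real (2 * r * t) * l + 1 / p) - exp (\<epsilon> * l) / 2 / p)"
    unfolding N by (simp flip: exp_add exp_of_nat_mult)
  also have "\<dots> \<le> exp (G' / p)"
  proof -
    have "(real r * (real t * l + 1 / p) + (real (2 * r * t) * l + 1 / p) - exp (\<epsilon> * l) / 2 / p) * p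
      = 3 * l * (real r * real t * p) + real r + 1 - exp (\<epsilon> * l) / 2"
      using p_pos by (simp add: field_simps)
    also have "\<dots> \<le> 3 * l * (6 * l * (4 * l + 1)) + 6 * l + 1 - exp (\<epsilon> * l) / 2"
      using rtp r6 l(1) by (intro diff_right_mono add_mono mult_left_mono) auto
    also have "\<dots> = G'" by (simp add: G'_def algebra_simps)
    finally show ?thesis using p_pos by (simp add: pos_le_divide_eq)
  qed
  also have "\<dots> \<le> exp G'" using G by (intro scale) (simp add: G'_def)
  finally have term2: "N t ^ r * N (2 * r * t) * (1 - (1 - mu p) ^ r) ^ (n - 3 * r * t) \<le> exp G'"
    by (simp add: \<pi>_def)
  have "prob (\<lambda>E. real (chi_CF {..<n} E) < (1 - \<epsilon>) * L)
    \<le> prob (\<lambda>E. \<exists>c :: nat \<Rightarrow> nat. c ` {..<n} \<subseteq> {..<r} \<and> conflict_free {..<n} E c)"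
  proof (rule prob_mono)
    fix E assume "real (chi_CF {..<n} E) < (1 - \<epsilon>) * L"
    then have "chi_CF {..<n} E \<le> r" unfolding r_def by (simp add: le_nat_iff le_floor_iff)
    then show "\<exists>c :: nat \<Rightarrow> nat. c ` {..<n} \<subseteq> {..<r} \<and> conflict_free {..<n} E c"
      using chi_CF_colouring_exists[of "{..<n}" E] by (meson finite_lessThan lessThan_subset_iff order_trans)
  qed
  then show ?thesis using main term1 term2 by (simp add: L_def c0_def G'_def)
qed

text \<open>\<open>prob_chi_CF_gt_le\<close> with \<open>r\<close> about
  \<open>(1 + \<delta>) * L\<close>, \<open>r'\<close> and \<open>2 * \<sigma>\<close> about
  \<open>\<delta> * L\<close>, and \<open>b\<close> about \<open>l\<close>. The summands account in
  turn for missing independent classes, too many unserved vertices, and small dense sets.\<close>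

lemma prob_chi_CF_greater_le:
  assumes "0 < \<delta>" "\<delta> < 1" and c0: "- ln (1 - mu p) \<le> K"
  defines "l \<equiv> ln (real n * p)"
  assumes l: "2 \<le> l" "5 * K \<le> \<delta> * l" "exp (1 + 4 * K / \<delta>) * K \<le> \<delta> * l"
    and fit: "(18 * l + 2) * (l + 1) \<le> exp l" and y: "3 * (l + 1) * exp (- ((l - 1) / 3)) \<le> 1"
  shows "prob (\<lambda>E. (1 + 4 * \<delta>) * (l / (- ln (1 - mu p))) < real (chi_CF {..<n} E))
    \<le> (18 * l + 2) * (3 * (l + 1) * exp (- ((l - 1) / 3))) + (exp (- \<delta> * l) + (12 * l + 1) * (l + 1) * exp (- \<delta> * l))
      + 2 * exp (1 - l)"
proof -
  define c0 where "c0 = - ln (1 - mu p)"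
  define L where "L = l / c0"
  define k where "k = nat \<lfloor>1 / p\<rfloor>"
  define b where "b = nat \<lceil>l\<rceil>"
  define r where "r = nat \<lceil>(1 + \<delta>) * L\<rceil>"
  define r' where "r' = nat \<lceil>\<delta> * L\<rceil>"
  define \<sigma> where "\<sigma> = nat \<lceil>\<delta> * L / 2\<rceil>"
  note k = floor_inverse_bounds[OF k_def]
  have np0: "0 < real n * p" using l(1) p_pos unfolding l_def by (cases n) auto
  have n1: "1 \<le> n" using np0 by (cases n) auto
  have np: "real n * p = exp l" using np0 by (simp add: l_def)
  have c0l: "1 / 6 \<le> c0" using neg_ln_mu_ge by (simp add: c0_def)
  have c0K: "c0 \<le> K" using c0 by (simp add: c0_def)
  have K0: "0 < K" using c0l c0K by simp
  have L: "0 < L" "L \<le> 6 * l" "l / K \<le> L"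
    using c0l c0K K0 l(1) by (auto simp: L_def field_simps)
  have nat_ceil: "x \<le> real (nat \<lceil>x\<rceil>)" "real (nat \<lceil>x\<rceil>) \<le> x + 1" if "0 \<le> x" for x :: real
    using that by linarith+
  have r: "(1 + \<delta>) * L \<le> real r" "real r \<le> (1 + \<delta>) * L + 1"
    unfolding r_def using L assms(1) by (intro nat_ceil; simp)+
  have r': "\<delta> * L \<le> real r'" "real r' \<le> \<delta> * L + 1"
    unfolding r'_def using L assms(1) by (intro nat_ceil; simp)+
  have \<sigma>: "\<delta> * L / 2 \<le> real \<sigma>" "real \<sigma> \<le> \<delta> * L / 2 + 1"
    unfolding \<sigma>_def using L assms(1) by (intro nat_ceil; simp)+
  have b: "l \<le> real b" "real b \<le> l + 1"
    unfolding b_def using l(1) by (intro nat_ceil; simp)+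
  have b1: "1 \<le> b" using b l(1) by linarith
  have dL: "\<delta> * L \<le> L" "0 < \<delta> * L" using L assms(1,2) by (auto simp: mult_le_cancel_right1)
  have r12: "real r \<le> 12 * l + 1" using r(2) dL L unfolding distrib_right by linarith
  have R18: "real (r + r') \<le> 18 * l + 2" using r(2) r'(2) dL L unfolding distrib_right by linarith
  have s1: "1 \<le> \<sigma>" using \<sigma>(1) dL by linarith
  have "\<delta> * (l / K) \<le> \<delta> * L" using L(3) assms(1) by (intro mult_left_mono) auto
  then have dlK: "\<delta> * l / K \<le> \<delta> * L" by simp
  \<comment> \<open>As \<open>k * p \<le> 1\<close>, all blocks together need at most
    \<open>(18 * l + 2) * (l + 1) / p\<close> vertices, and \<open>n = exp l / p\<close>.\<close>
  have fit': "(r + r') * (k * b) \<le> n"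
  proof -
    have "real (r + r') * real b \<le> (18 * l + 2) * (l + 1)"
      using R18 b l(1) by (intro mult_mono) auto
    then have "real (r + r') * real b * (real k * p) \<le> exp l * 1"
      using fit k(2) p_pos by (intro mult_mono) auto
    then have "real ((r + r') * (k * b)) * p \<le> real n * p" unfolding np by (simp add: mult_ac)
    then have "real ((r + r') * (k * b)) \<le> real n" using p_pos by (simp only: mult_le_cancel_right_pos)
    then show ?thesis by (simp only: of_nat_le_iff)
  qed
  define Y where "Y = real b * exp 1 * (1 - (1 - p) ^ (k - 1)) ^ (b - 1)"
  define Z where "Z = exp 1 * (real n * p) * (exp 1 / (2 * real \<sigma>)) ^ \<sigma>"
  \<comment> \<open>A vertex has a neighbour in a given set of \<open>k - 1\<close> others with
    probability at most \<open>1 - exp (-1) \<le> 2 / 3 \<le> exp (- (1 / 3))\<close>.\<close>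
  have "1 / 3 \<le> exp (-1 :: real)" using exp_le by (simp add: exp_minus field_simps)
  then have \<theta>: "1 - (1 - p) ^ (k - 1) \<le> exp (- (1 / 3))"
    using k(4) exp_ge_add_one_self[of "- (1 / 3) :: real"] by simp
  have \<theta>0: "0 \<le> 1 - (1 - p) ^ (k - 1)" using p_pos p_less_1 by (simp add: power_le_one)
  have "(1 - (1 - p) ^ (k - 1)) ^ (b - 1) \<le> exp (- (1 / 3)) ^ (b - 1)"
    using \<theta> \<theta>0 by (intro power_mono)
  also have "\<dots> = exp (- (real (b - 1) / 3))" by (simp flip: exp_of_nat_mult)
  also have "\<dots> \<le> exp (- ((l - 1) / 3))" using b b1 by (simp add: of_nat_diff)
  finally have "Y \<le> (l + 1) * 3 * exp (- ((l - 1) / 3))"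
    unfolding Y_def using b \<theta>0 exp_le l(1) by (intro mult_mono) auto
  then have Y: "Y \<le> 3 * (l + 1) * exp (- ((l - 1) / 3))" by (simp only: mult_ac)
  have Z: "Z \<le> exp (1 - l)"
  proof -
    \<comment> \<open>Chosen so that \<open>a * \<sigma> \<ge> 2 * l\<close>, while
      \<open>2 * \<sigma> \<ge> exp (1 + a)\<close>; the power then contributes
      \<open>exp (- (2 * l))\<close> against \<open>n * p = exp l\<close>.\<close>
    define a where "a = 4 * K / \<delta>"
    have "exp (1 + a) \<le> \<delta> * l / K" using l(3) K0 by (simp add: a_def field_simps)
    also have "\<dots> \<le> 2 * real \<sigma>" using dlK \<sigma>(1) by simp
    finally have "exp 1 * exp a \<le> 2 * real \<sigma>" by (simp add: exp_add)
    then have "exp 1 / (2 * real \<sigma>) \<le> exp (- a)" using s1 by (simp add: exp_minus field_simps)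
    then have "(exp 1 / (2 * real \<sigma>)) ^ \<sigma> \<le> exp (- a) ^ \<sigma>" by (intro power_mono) auto
    also have "\<dots> = exp (- (a * real \<sigma>))" by (simp add: mult.commute flip: exp_of_nat_mult)
    also have "\<dots> \<le> exp (- (2 * l))"
    proof -
      have "2 * l = a * (\<delta> * l / K / 2)" using K0 assms(1) by (simp add: a_def)
      also have "\<dots> \<le> a * real \<sigma>" using dlK \<sigma>(1) K0 assms(1) by (intro mult_left_mono) (auto simp: a_def)
      finally show ?thesis by simp
    qed
    finally have "Z \<le> exp 1 * exp l * exp (- (2 * l))"
      unfolding Z_def np by (intro mult_left_mono) auto
    then show ?thesis by (simp add: mult.assoc flip: exp_add)
  qed
  have "exp (1 - l) \<le> 1 / 2"
  proof -
    have "2 \<le> exp (l - 1)" using exp_ge_add_one_self[of "l - 1"] l(1) by linarith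
    then have "exp (- (l - 1)) \<le> 1 / 2" by (subst exp_minus) (simp add: field_simps)
    then show ?thesis by simp
  qed
  with Z have Zhalf: "Z \<le> 1 / 2" by linarith
  \<comment> \<open>The surplus of \<open>\<delta> * L\<close> classes brings the expected number of
    unserved vertices outside the blocks down to \<open>exp (- \<delta> * l) / p\<close>.\<close>
  have pow_r: "real n * p * (1 - mu p) ^ r \<le> exp (- \<delta> * l)"
  proof -
    have "(1 + \<delta>) * l \<le> c0 * real r" using mult_left_mono[OF r(1), of c0] c0l by (simp add: L_def mult_ac)
    then have "exp l * exp (- (c0 * real r)) \<le> exp l * exp (- ((1 + \<delta>) * l))" by simp
    also have "\<dots> = exp (- \<delta> * l)" by (simp add: algebra_simps flip: exp_add)
    finally show ?thesis unfolding np power_mu c0_def .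
  qed
  have pow_r': "(1 - mu p) ^ r' \<le> exp (- \<delta> * l)"
  proof -
    have "\<delta> * l \<le> c0 * real r'" using mult_left_mono[OF r'(1), of c0] c0l by (simp add: L_def mult_ac)
    then show ?thesis unfolding power_mu c0_def[symmetric] by simp
  qed
  have "prob (\<lambda>E. (1 + 4 * \<delta>) * L < real (chi_CF {..<n} E)) \<le> prob (\<lambda>E. r + r' + 2 * \<sigma> + 1 < chi_CF {..<n} E)"
  proof (rule prob_mono)
    fix E assume chi: "(1 + 4 * \<delta>) * L < real (chi_CF {..<n} E)"
    \<comment> \<open>Rounding and the dummy cost 5 colours: one each for \<open>r\<close> and
      \<open>r'\<close>, two for \<open>2 * \<sigma>\<close>, one for the dummy. The fourth
      \<open>\<delta> * L\<close> covers them.\<close>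
    have "5 \<le> \<delta> * l / K" using l(2) K0 by (simp add: field_simps)
    then have "real (r + r' + 2 * \<sigma> + 1) \<le> (1 + 4 * \<delta>) * L"
      using r(2) r'(2) \<sigma>(2) dlK by (simp add: algebra_simps)
    then show "r + r' + 2 * \<sigma> + 1 < chi_CF {..<n} E" using chi by linarith
  qed
  also have "\<dots> \<le> real (r + r') * Y + p * (real n * (1 - mu p) ^ r + real (r * (k * b)) * (1 - mu p) ^ r') + 2 * Z"
    unfolding Y_def Z_def
  proof (rule prob_chi_CF_gt_le[OF k_def b1 s1 n1 fit'])
    show "real b * exp 1 * (1 - (1 - p) ^ (k - 1)) ^ (b - 1) \<le> 1" using Y y by (simp add: Y_def)
    show "exp 1 * (real n * p) * (exp 1 / (2 * real \<sigma>)) ^ \<sigma> \<le> 1 / 2" using Zhalf by (simp add: Z_def)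
  qed
  also have "\<dots> \<le> (18 * l + 2) * (3 * (l + 1) * exp (- ((l - 1) / 3))) + (exp (- \<delta> * l) + (12 * l + 1) * (l + 1) * exp (- \<delta> * l))
      + 2 * exp (1 - l)"
  proof (intro add_mono)
    show "real (r + r') * Y \<le> (18 * l + 2) * (3 * (l + 1) * exp (- ((l - 1) / 3)))"
      using R18 Y \<theta>0 l(1) by (intro mult_mono) (auto simp: Y_def)
    have "real r * real b * (real k * p) * (1 - mu p) ^ r' \<le> ((12 * l + 1) * (l + 1) * 1) * exp (- \<delta> * l)"
      using r12 b k(2) pow_r' l(1) p_pos mu_less_1 by (intro mult_mono) auto
    then show "p * (real n * (1 - mu p) ^ r + real (r * (k * b)) * (1 - mu p) ^ r') \<le>
        exp (- \<delta> * l) + (12 * l + 1) * (l + 1) * exp (- \<delta> * l)"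
      using pow_r by (simp add: algebra_simps)
    show "2 * Z \<le> 2 * exp (1 - l)" using Z by simp
  qed
  finally show ?thesis by (simp add: L_def c0_def)
qed

end

theorem theorem1:
  fixes \<epsilon> :: real and p :: "nat \<Rightarrow> real"
  assumes "\<epsilon> > 0"
    and "\<And>n. n \<ge> 1 \<Longrightarrow> 0 < p n \<and> p n < 1 - \<epsilon>"
    and "filterlim (\<lambda>n. real n * p n) at_top sequentially"
  shows "(\<lambda>n. measure_pmf.prob (gnp n (p n))
            {E. (1 - \<epsilon>) * (ln (real n * p n) / (- ln (1 - mu (p n)))) \<le> real (chi_CF {..<n} E) \<and>
                real (chi_CF {..<n} E) \<le> (1 + \<epsilon>) * (ln (real n * p n) / (- ln (1 - mu (p n))))})
         \<longlonglongrightarrow> 1"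
proof -
  \<comment> \<open>The single instance \<open>n = 1\<close> forces
    \<open>\<epsilon> < 1\<close>.\<close>
  have "0 < p 1 \<and> p 1 < 1 - \<epsilon>" using assms(2) by simp
  then have eps: "0 < \<epsilon>" "\<epsilon> < 1" using assms(1) by auto
  \<comment> \<open>The bound on \<open>- ln (1 - mu (p n))\<close> from
    \<open>neg_ln_mu_le\<close>, uniform in \<open>n\<close>.\<close>
  define K where "K = 1 - ln \<epsilon>"
  define \<delta> where "\<delta> = \<epsilon> / 4"
  have \<delta>: "0 < \<delta>" "\<delta> < 1" "4 * \<delta> = \<epsilon>" using eps by (auto simp: \<delta>_def)
  define l where "l n = ln (real n * p n)" for n
  have l: "filterlim l at_top sequentially"
    unfolding l_def by (rule filterlim_compose[OF ln_at_top assms(3)])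
  define G where "G x = 6 * x * (3 * x * (4 * x + 1) + 1) + 1 - exp (\<epsilon> * x) / 2" for x
  define low where "low x = exp (2 - 4 * x\<^sup>2) + exp (G x)" for x
  define up where "up x = (18 * x + 2) * (3 * (x + 1) * exp (- ((x - 1) / 3)))
    + (exp (- \<delta> * x) + (12 * x + 1) * (x + 1) * exp (- \<delta> * x)) + 2 * exp (1 - x)" for x
  \<comment> \<open>The side conditions of both estimates concern \<open>x = l n\<close> alone,
    uniformly in \<open>p\<close>, so it suffices that they hold for all large real
    \<open>x\<close>.\<close>
  have cond: "eventually (\<lambda>x :: real. 2 \<le> x) at_top"
    "eventually (\<lambda>x :: real. (4 * x + 2) * 3 \<le> exp x) at_top"
    "eventually (\<lambda>x :: real. 36 * x * (4 * x + 1) \<le> exp x) at_top"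
    "eventually (\<lambda>x :: real. (18 * x + 2) * (x + 1) \<le> exp x) at_top"
    "eventually (\<lambda>x :: real. 3 * (x + 1) * exp (- ((x - 1) / 3)) \<le> 1) at_top"
    "eventually (\<lambda>x. G x \<le> 0) at_top"
    "eventually (\<lambda>x. 5 * K / \<delta> \<le> x) at_top"
    "eventually (\<lambda>x. exp (1 + 4 * K / \<delta>) * K / \<delta> \<le> x) at_top"
    using eps(1) \<delta>(1) unfolding G_def by (real_asymp | rule eventually_ge_at_top)+
  have low_lim: "(low \<longlongrightarrow> 0) at_top"
    using eps(1) unfolding low_def G_def by real_asymp
  have up_lim: "(up \<longlongrightarrow> 0) at_top"
    unfolding up_def
  proof (intro tendsto_add_zero)
    show "((\<lambda>x :: real. (18 * x + 2) * (3 * (x + 1) * exp (- ((x - 1) / 3)))) \<longlongrightarrow> 0) at_top"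
      by real_asymp
    show "((\<lambda>x. exp (- \<delta> * x)) \<longlongrightarrow> 0) at_top"
      using \<delta>(1) by real_asymp
    show "((\<lambda>x. (12 * x + 1) * (x + 1) * exp (- \<delta> * x)) \<longlongrightarrow> 0) at_top"
      using \<delta>(1) by real_asymp
    show "((\<lambda>x :: real. 2 * exp (1 - x)) \<longlongrightarrow> 0) at_top"
      by real_asymp
  qed
  define good where "good n E \<longleftrightarrow> (1 - \<epsilon>) * (l n / (- ln (1 - mu (p n)))) \<le> real (chi_CF {..<n} E) \<and>
    real (chi_CF {..<n} E) \<le> (1 + \<epsilon>) * (l n / (- ln (1 - mu (p n))))" for n E
  have lower: "eventually (\<lambda>n. 1 - (low (l n) + up (l n)) \<le> measure_pmf.prob (gnp n (p n)) {E. good n E}) sequentially"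
    using cond[THEN filterlim_iff[THEN iffD1, OF l, rule_format]] eventually_ge_at_top[of 1]
  proof eventually_elim
    case (elim n)
    have pn: "0 < p n" "p n < 1 - \<epsilon>" using assms(2) elim by auto
    interpret gnp_graph n "p n" using pn eps by unfold_locales auto
    let ?L = "l n / (- ln (1 - mu (p n)))"
    have "prob (\<lambda>E. \<not> good n E) \<le> prob (\<lambda>E. real (chi_CF {..<n} E) < (1 - \<epsilon>) * ?L \<or> (1 + 4 * \<delta>) * ?L < real (chi_CF {..<n} E))"
      unfolding \<delta>(3) by (rule prob_mono) (auto simp: good_def not_le)
    also have "\<dots> \<le> prob (\<lambda>E. real (chi_CF {..<n} E) < (1 - \<epsilon>) * ?L) + prob (\<lambda>E. (1 + 4 * \<delta>) * ?L < real (chi_CF {..<n} E))"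
      by (rule prob_disj_le)
    also have "\<dots> \<le> low (l n) + up (l n)"
    proof (rule add_mono)
      show "prob (\<lambda>E. real (chi_CF {..<n} E) < (1 - \<epsilon>) * ?L) \<le> low (l n)"
        using elim eps unfolding low_def G_def l_def by (intro prob_chi_CF_less_le) auto
      show "prob (\<lambda>E. (1 + 4 * \<delta>) * ?L < real (chi_CF {..<n} E)) \<le> up (l n)"
        unfolding up_def l_def
      proof (rule prob_chi_CF_greater_le[where K = K])
        show "- ln (1 - mu (p n)) \<le> K" unfolding K_def using eps(1) pn by (intro neg_ln_mu_le) auto
        show "5 * K \<le> \<delta> * ln (real n * p n)" "exp (1 + 4 * K / \<delta>) * K \<le> \<delta> * ln (real n * p n)"
          using elim \<delta>(1) by (simp_all add: l_def pos_divide_le_eq mult.commute)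
      qed (use elim \<delta> in \<open>auto simp: l_def\<close>)
    qed
    finally show ?case unfolding prob_Not by simp
  qed
  have "(\<lambda>n. 1 - (low (l n) + up (l n))) \<longlonglongrightarrow> 1 - (0 + 0)"
    by (intro tendsto_diff tendsto_add tendsto_const filterlim_compose[OF low_lim l] filterlim_compose[OF up_lim l])
  then have lim: "(\<lambda>n. 1 - (low (l n) + up (l n))) \<longlonglongrightarrow> 1" by simp
  have "(\<lambda>n. measure_pmf.prob (gnp n (p n)) {E. good n E}) \<longlonglongrightarrow> 1"
    by (rule tendsto_sandwich[OF lower _ lim tendsto_const]) (rule always_eventually, rule allI, rule measure_pmf.prob_le_1)
  then show ?thesis unfolding good_def l_def .
qed

end
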